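(* Let $u\in\mathcal{S}_n$ and let $k,l$ be the number of levels in $T^n(u)$ labeled $0$ and $1$, respectively. Then: \begin{itemize} \item The number of words in each super-strong Wilf equivalence class in $T^n(u)$ (that is, each super-strong Wilf equivalence class consisting of leaves of $T^n(u)$) is equal to $2^k$. \item The class $[u]_+$ is partitioned into $2^l$ distinct super-strong Wilf equivalence classes. \end{itemize}
   Context: Super-strong Wilf equivalence. $\mathbb{P}$ is the set of positive integers and $\mathbb{P}^*$ the set of finite words over $\mathbb{P}$. For $w=w_1\cdots w_n\in\mathbb{P}^*$, $|w|=n$ is its length and $\|w\|=w_1+\cdots+w_n$ its height. For words $u,w$, an index $j\ge 1$ is an embedding index of $u$ into $w$ if $j+|u|-1\le|w|$ and $u_i\le w_{j+i-1}$ for all $1\le i\le|u|$; $Em(u,w)$ is the set of all embedding indices of $u$ into $w$. Two words $u,v$ are super-strongly Wilf equivalent, $u\sim_{ss}v$, if there is a bijection $f:\mathbb{P}^*\to\mathbb{P}^*$ with $|f(w)|=|w|$, $\|f(w)\|=\|w\|$ and $Em(u,w)=Em(v,f(w))$ for all $w\in\mathbb{P}^*$. Cross equivalence. $\mathcal{S}_n$ is the set of permutations of $\{1,\ldots,n\}$, viewed as words. For $u\in\mathcal{S}_n$ with inverse $s=u^{-1}$ ($s_i$ is the position of letter $i$ in $u$), $i^+(u)$ is the multiset $\{|s_i-s_j|: i<j\le n\}$ (so $n^+(u)=\varnothing$). Permutations $u,v\in\mathcal{S}_n$ are cross equivalent, $u\sim_+v$, if $i^+(u)=i^+(v)$ for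 all $1\le i\le n-1$; $[u]_+$ is the cross equivalence class of $u$. The tree $T^n(u)$. For $0\le i\le n$ let $S_i^n$ be the set of words of length $n$ over $\{1,\ldots,n,*\}$ in which each of $1,\ldots,i$ occurs exactly once and $*$ occurs $n-i$ times. The ordered rooted tree $T^n(u)$ has root $*^n$ (level $0$); its vertices at level $i$ are the $x\in S_i^n$ such that for every $j\in\{1,\ldots,i\}$ the multiset of distances $|k-l|$ with $x_k=j$ and $x_l\in\{j+1,\ldots,i\}\cup\{*\}$ equals $j^+(u)$. A vertex $y$ at level $i+1$ is a child of a vertex $x$ at level $i$ if each of the letters $1,\ldots,i$ occupies the same position in $x$ and $y$. If $y,y'$ are two children of $x$, $y$ is to the left of $y'$ when the position of $i+1$ in $y$ is smaller than its position in $y'$. The leaves (level $n$) are the elements of $[u]_+$. At each level $i<n$ all vertices have the same number of children, which is $1$ or $2$. Labels. For a vertex $x$ containing at least one $*$, $f(x)$ is the factor of $x$ beginning at the first $*$ and ending at the last $*$, and $c(x)$ is the word over $\{*,\circ\}$ obtained from $f(x)$ by replacing each letter different from $*$ by $\circ$. A vertex $x$ with two children $y,y'$ is labeled $0$ if $c(y)=c(y')$ and $1$ otherwise. All vertices of the same level have the same label; a level whose vertices have two children is said to be labeled $0$ or $1$ accordingly, and levels whose vertices have only one child are unlabeled. *)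

theory Defs
  imports Main "HOL-Library.Multiset" "HOL-Library.Disjoint_Sets"
    "HOL-Combinatorics.Multiset_Permutations"
begin

(* Words over the positive integers are lists of naturals; letters are numbered from 1
   in formulas, so the letter w_i is w ! (i - 1). *)

definition pos_words :: "nat list set" where
  "pos_words = {w. \<forall>a\<in>set w. 1 \<le> a}"

definition Em :: "nat list \<Rightarrow> nat list \<Rightarrow> nat set" where
  "Em u w = {j. 1 \<le> j \<and> j + length u - 1 \<le> length w \<and>
     (\<forall>i\<in>{1..length u}. u ! (i - 1) \<le> w ! (j + i - 1 - 1))}"

definition super_strong_Wilf :: "(nat list \<times> nat list) set" where
  "super_strong_Wilf = {(u, v). u \<in> pos_words \<and> v \<in> pos_words \<and>
     (\<exists>f. bij_betw f pos_words pos_words \<and>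
        (\<forall>w\<in>pos_words. length (f w) = length w \<and> sum_list (f w) = sum_list w \<and>
           Em u w = Em v (f w)))}"

definition absdiff :: "nat \<Rightarrow> nat \<Rightarrow> nat" where
  "absdiff a b = nat \<bar>int a - int b\<bar>"

definition pos_of :: "nat list \<Rightarrow> nat \<Rightarrow> nat" where
  "pos_of u i = (THE k. k \<in> {1..length u} \<and> u ! (k - 1) = i)"

definition plus_mset :: "nat list \<Rightarrow> nat \<Rightarrow> nat multiset" where
  "plus_mset u i = image_mset (\<lambda>j. absdiff (pos_of u i) (pos_of u j)) (mset_set {i<..length u})"

definition cross_class :: "nat \<Rightarrow> nat list \<Rightarrow> nat list set" where
  "cross_class n u = {v \<in> permutations_of_set {1..n}.
     \<forall>i. 1 \<le> i \<and> i \<le> n - 1 \<longrightarrow> plus_mset u i = plus_mset v i}"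

(* Words over {1,...,n,*}: the letter j is Some j, and * is None. *)

definition star_words :: "nat \<Rightarrow> nat \<Rightarrow> nat option list set" where
  "star_words n i = {x. length x = n \<and> set x \<subseteq> insert None (Some ` {1..n}) \<and>
     (\<forall>j\<in>{1..i}. count_list x (Some j) = 1) \<and> count_list x None = n - i}"

definition star_plus_mset :: "nat \<Rightarrow> nat option list \<Rightarrow> nat \<Rightarrow> nat multiset" where
  "star_plus_mset i x j = image_mset (\<lambda>(k, l). absdiff k l)
     (mset_set {(k, l). k < length x \<and> l < length x \<and>
        x ! k = Some j \<and> x ! l \<in> insert None (Some ` {j+1..i})})"

definition tree_level :: "nat \<Rightarrow> nat list \<Rightarrow> nat \<Rightarrow> nat option list set" where
  "tree_level n u i = {x \<in> star_words n i. \<forall>j\<in>{1..i}. star_plus_mset i x j = plus_mset u j}"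

definition children :: "nat \<Rightarrow> nat list \<Rightarrow> nat \<Rightarrow> nat option list \<Rightarrow> nat option list set" where
  "children n u i x = {y \<in> tree_level n u (i + 1).
     \<forall>j\<in>{1..i}. \<forall>k<n. x ! k = Some j \<longleftrightarrow> y ! k = Some j}"

definition leaves :: "nat \<Rightarrow> nat list \<Rightarrow> nat list set" where
  "leaves n u = {v. map Some v \<in> tree_level n u n}"

definition star_factor :: "nat option list \<Rightarrow> nat option list" where
  "star_factor x =
     rev (dropWhile (\<lambda>a. a \<noteq> None) (rev (dropWhile (\<lambda>a. a \<noteq> None) x)))"

datatype shape = Star | Circ

definition contour :: "nat option list \<Rightarrow> shape list" where
  "contour x = map (\<lambda>a. if a = None then Star else Circ) (star_factor x)"

definition vertex_labeled :: "nat \<Rightarrow> nat list \<Rightarrow> nat \<Rightarrow> nat option list \<Rightarrow> nat \<Rightarrow> bool" where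
  "vertex_labeled n u i x b \<longleftrightarrow>
     (\<exists>y y'. y \<noteq> y' \<and> children n u i x = {y, y'} \<and>
        b = (if contour y = contour y' then 0 else 1))"

(* Levels up to n are nonempty (replacing the letters above i in u by * gives a vertex at
   level i), so the universal quantifier is not vacuous. *)
definition level_labeled :: "nat \<Rightarrow> nat list \<Rightarrow> nat \<Rightarrow> nat \<Rightarrow> bool" where
  "level_labeled n u i b \<longleftrightarrow> (\<forall>x\<in>tree_level n u i. vertex_labeled n u i x b)"

end

theory Submission
  imports Defs
begin

text \<open>
  Both counts come from describing the two equivalences by the sets
  \<open>U_t = {positions of the letters of u that are \<ge> t}\<close>, here \<open>level_set u t\<close>, regarded as sets of
  integers.

  \<^emph>\<open>Super-strong Wilf equivalence.\<close> Words \<open>u\<close> and \<open>v\<close> of positive integers are equivalent iff they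
  have the same length and \<open>V_t\<close> is a translate of \<open>U_t\<close> for every \<open>t\<close>
  (\<open>super_strong_Wilf_iff\<close>). The words in which \<open>u\<close> embeds at all places of a set \<open>E\<close> are those
  lying pointwise above the smallest such word, the cluster of \<open>u\<close> at \<open>E\<close>; counted by length and
  height they depend only on the height of the cluster, which is, up to a term that depends only on
  the lengths and on \<open>E\<close>, the sum over \<open>t\<close> of the sizes of the sumsets \<open>U_t + E\<close>. Translates have
  equal sumset sizes, so translated level sets give equal counts, and inversion over supersets of
  \<open>E\<close> turns these counts into a bijection.
  Conversely, a bijection forces equal cluster heights. Compare a long interval \<open>E\<close> with
  the same interval after removal of a finite set \<open>F\<close>: the sums of sumset sizes differ by the number
  of mirrored translates of the \<open>U_t\<close> that fit into \<open>F\<close>. At the largest \<open>t\<close> where \<open>U_t\<close> and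
  \<open>V_t\<close> are not translates, choosing \<open>F\<close> to be the mirror image of the smaller of the two sets
  gives a contradiction
  (\<open>decreasing_families_translates\<close>).

  \<^emph>\<open>The tree.\<close> Let \<open>S\<close> be the set of star positions of a vertex at level \<open>i\<close>. Its children
  correspond to the points of \<open>S\<close> whose multiset of distances to the rest of \<open>S\<close> is the prescribed
  one (\<open>removable\<close>). If two different points \<open>p\<close>, \<open>q\<close> qualify, then \<open>S\<close> is symmetric under
  \<open>x \<mapsto> p + q - x\<close> (\<open>two_removable_reflection\<close>). Hence there are at most two such points, and removing
  one or the other leaves mirror images. By induction all star sets of a level are congruent
  (\<open>above_congruent\<close>), so the number of children and the label depend on the level only. Since equal
  contours mean translated star sets (\<open>contour_eq_iff\<close>), label 0 says that both children are
  translates of each other, label 1 that they are not.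

  \<^emph>\<open>Counting.\<close> Every labeled level doubles the number of vertices, so the cross equivalence class,
  which is the set of leaves, has \<open>2 ^ (k + l)\<close> elements. Equivalent permutations are cross
  equivalent, because the multiset of all distances inside a set is invariant under translations;
  so the class of a leaf \<open>v\<close> consists of the leaves all of whose ancestors have star sets that are
  translates of those of \<open>v\<close>. Along these vertices a level labeled 0 doubles and any other level
  preserves the number, which gives classes of size \<open>2 ^ k\<close>, and thus \<open>2 ^ l\<close> of them.
\<close>

section \<open>Distance multisets of finite sets of integers\<close>

definition translates :: "int set \<Rightarrow> int set \<Rightarrow> bool" where
  "translates S T \<longleftrightarrow> (\<exists>c. T = (+) c ` S)"

lemma translates_refl: "translates S S"
  unfolding translates_def by (rule exI[of _ 0]) simp

lemma translates_sym:
  assumes "translates S T" shows "translates T S"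
proof -
  obtain c where "T = (+) c ` S" using assms unfolding translates_def by blast
  then have "S = (+) (- c) ` T" by (simp add: image_image)
  then show ?thesis unfolding translates_def by blast
qed

lemma translates_trans:
  assumes "translates R S" "translates S T" shows "translates R T"
proof -
  obtain b c where "S = (+) b ` R" "T = (+) c ` S" using assms unfolding translates_def by blast
  then have "T = (+) (c + b) ` R" by (simp add: image_image add.assoc)
  then show ?thesis unfolding translates_def by blast
qed

lemma translates_card: "translates S T \<Longrightarrow> card S = card T"
  unfolding translates_def by (auto simp: card_image)

text \<open>
  Iterating the shift would run out of a finite set; comparing the sums of the elements of \<open>Z\<close>
  and of \<open>Z + d = Z\<close> avoids the iteration.
\<close>

lemma finite_shift_invariant_empty:
  fixes Z :: "int set"
  assumes "finite Z" "d \<noteq> 0" and closed: "\<And>x. x \<in> Z \<Longrightarrow> x + d \<in> Z"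
  shows "Z = {}"
proof -
  have inj: "inj_on (\<lambda>x. x + d) Z" by (simp add: inj_on_def)
  have "(\<lambda>x. x + d) ` Z = Z"
    using assms inj by (intro endo_inj_surj) auto
  then have "\<Sum>Z = (\<Sum>x\<in>Z. x + d)"
    using sum.reindex[OF inj, of "\<lambda>x. x"] by (simp add: o_def)
  also have "\<dots> = \<Sum>Z + int (card Z) * d" by (simp add: sum.distrib)
  finally show ?thesis using assms by simp
qed

definition dists :: "int \<Rightarrow> int set \<Rightarrow> nat multiset" where
  "dists p S = image_mset (\<lambda>q. nat \<bar>p - q\<bar>) (mset_set S)"

text \<open>
  For a star set \<open>S\<close> and the distance multiset \<open>D\<close> prescribed for the next letter, these are
  the positions where that letter may be placed.
\<close>

definition removable :: "nat multiset \<Rightarrow> int set \<Rightarrow> int set" where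
  "removable D S = {p \<in> S. dists p (S - {p}) = D}"

lemma finite_removable: "finite S \<Longrightarrow> finite (removable D S)"
  by (simp add: removable_def)

lemma dists_image:
  assumes "inj_on g S" and "\<And>q. q \<in> S \<Longrightarrow> \<bar>g p - g q\<bar> = \<bar>p - q\<bar>"
  shows "dists (g p) (g ` S) = dists p S"
proof -
  have "mset_set (g ` S) = image_mset g (mset_set S)"
    using assms(1) by (simp add: image_mset_mset_set)
  then have "dists (g p) (g ` S) = image_mset (\<lambda>q. nat \<bar>g p - g q\<bar>) (mset_set S)"
    by (simp add: dists_def multiset.map_comp o_def)
  also have "\<dots> = dists p S"
    unfolding dists_def by (cases "finite S") (auto intro!: image_mset_cong simp: assms(2))
  finally show ?thesis .
qed

lemma removable_image:
  fixes g :: "int \<Rightarrow> int"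
  assumes iso: "\<And>p q. \<bar>g p - g q\<bar> = \<bar>p - q\<bar>"
  shows "removable D (g ` S) = g ` removable D S"
proof -
  have inj: "inj g"
    using iso by (metis abs_eq_0 eq_iff_diff_eq_0 injI)
  have "dists (g p) (g ` S - {g p}) = dists p (S - {p})" for p
  proof -
    have "g ` S - {g p} = g ` (S - {p})"
      using inj by (auto simp: inj_def)
    then show ?thesis
      using dists_image[of g "S - {p}" p] inj iso by (metis inj_on_subset subset_UNIV)
  qed
  then show ?thesis unfolding removable_def by auto
qed

text \<open>
  Both sides are the multiplicity of the distance \<open>\<bar>d\<bar>\<close> in \<open>D\<close>, except for \<open>d = 0\<close>, where both
  are 2. The form with signed \<open>d\<close> is what the periodicity argument below needs.
\<close>

lemma removable_balance:
  assumes "finite S" "p \<in> removable D S" "q \<in> removable D S"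
  shows "of_bool (p + d \<in> S) + of_bool (p - d \<in> S)
       = (of_bool (q + d \<in> S) + of_bool (q - d \<in> S) :: int)"
proof (cases "d = 0")
  case True
  then show ?thesis using assms by (simp add: removable_def)
next
  case False
  have cnt: "int (count (dists r (S - {r})) (nat \<bar>d\<bar>))
      = of_bool (r + d \<in> S) + of_bool (r - d \<in> S)" for r
  proof -
    have "count (dists r (S - {r})) (nat \<bar>d\<bar>)
        = card ((\<lambda>q. nat \<bar>r - q\<bar>) -` {nat \<bar>d\<bar>} \<inter> (S - {r}))"
      using assms(1) by (simp add: dists_def count_image_mset)
    also have "(\<lambda>q. nat \<bar>r - q\<bar>) -` {nat \<bar>d\<bar>} \<inter> (S - {r}) = {x \<in> S - {r}. nat \<bar>r - x\<bar> = nat \<bar>d\<bar>}"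
      by auto
    also have "{x \<in> S - {r}. nat \<bar>r - x\<bar> = nat \<bar>d\<bar>} = {r + d, r - d} \<inter> S"
      using False by auto
    also have "int (card \<dots>) = of_bool (r + d \<in> S) + of_bool (r - d \<in> S)"
      using False by (auto simp: Int_insert_left)
    finally show ?thesis .
  qed
  have "dists p (S - {p}) = dists q (S - {q})"
    using assms by (simp add: removable_def)
  then show ?thesis using cnt[of p] cnt[of q] by simp
qed

text \<open>
  Let \<open>f\<close> be the indicator function of \<open>S\<close> minus that of its reflection under \<open>x \<mapsto> p + q - x\<close>.
  Equality of the distance multisets of \<open>p\<close> and \<open>q\<close> says exactly that \<open>f\<close> has period \<open>q - p\<close>.
  Its support is finite, so \<open>f = 0\<close>.
\<close>

lemma two_removable_reflection:
  assumes "finite S" "p \<in> removable D S" "q \<in> removable D S" "p \<noteq> q"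
  shows "(-) (p + q) ` S = S"
proof -
  define f where "f x = (of_bool (x \<in> S) - of_bool (p + q - x \<in> S) :: int)" for x
  define Z where "Z = {x. f x \<noteq> 0}"
  have "Z \<subseteq> S \<union> (-) (p + q) ` S"
  proof
    fix x assume "x \<in> Z"
    then have "x \<in> S \<or> p + q - x \<in> S" by (auto simp: Z_def f_def)
    then show "x \<in> S \<union> (-) (p + q) ` S" by (auto simp: image_iff intro: bexI[of _ "p + q - x"])
  qed
  then have "finite Z" using assms(1) by (meson finite_UnI finite_imageI finite_subset)
  have per: "f (x + (q - p)) = f x" for x
    using removable_balance[OF assms(1-3), of "x - p"]
    by (simp add: f_def algebra_simps)
  have "Z = {}"
    by (rule finite_shift_invariant_empty[OF \<open>finite Z\<close>, of "q - p"])
      (use assms(4) per in \<open>auto simp: Z_def\<close>)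
  then have "x \<in> S \<longleftrightarrow> p + q - x \<in> S" for x
    by (auto simp: Z_def f_def of_bool_def split: if_splits)
  then show ?thesis by (force simp: image_iff)
qed

text \<open>
  A third such point would give a second reflection symmetry of \<open>S\<close>; the composition of the two
  reflections is a nontrivial translation preserving a finite nonempty set.
\<close>

lemma removable_two_eq:
  assumes "finite S" "p \<in> removable D S" "q \<in> removable D S" "p \<noteq> q"
  shows "removable D S = {p, q}"
proof (rule ccontr)
  assume "removable D S \<noteq> {p, q}"
  then obtain r where r: "r \<in> removable D S" "r \<noteq> p" "r \<noteq> q" using assms by blast
  have 1: "(-) (p + q) ` S = S" by (rule two_removable_reflection[OF assms])
  have 2: "(-) (p + r) ` S = S"
    using two_removable_reflection[OF assms(1,2) r(1)] r(2) by blast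
  have "S = {}"
  proof (rule finite_shift_invariant_empty[OF assms(1), of "q - r"])
    show "q - r \<noteq> 0" using r(3) by simp
    fix x assume "x \<in> S"
    then have "p + r - x \<in> S" using 2 by blast
    then have "p + q - (p + r - x) \<in> S" using 1 by blast
    then show "x + (q - r) \<in> S" by (simp add: algebra_simps)
  qed
  then show False using assms(2) by (simp add: removable_def)
qed

definition congruent_sets :: "int set \<Rightarrow> int set \<Rightarrow> bool" where
  "congruent_sets S T \<longleftrightarrow> (\<exists>e c. (e = 1 \<or> e = -1) \<and> T = (\<lambda>x. e * x + c) ` S)"

lemma translates_imp_congruent: "translates S T \<Longrightarrow> congruent_sets S T"
  unfolding translates_def congruent_sets_def
  by (metis (no_types, lifting) add.commute image_cong mult_1)

lemma congruent_sets_trans: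
  assumes "congruent_sets R S" "congruent_sets S T" shows "congruent_sets R T"
proof -
  obtain e c where 1: "e = 1 \<or> e = -1" "S = (\<lambda>x. e * x + c) ` R"
    using assms(1) unfolding congruent_sets_def by blast
  obtain e' c' where 2: "e' = 1 \<or> e' = -1" "T = (\<lambda>x. e' * x + c') ` S"
    using assms(2) unfolding congruent_sets_def by blast
  have "T = (\<lambda>x. (e' * e) * x + (e' * c + c')) ` R"
    unfolding 1(2) 2(2) image_image by (intro image_cong) (auto simp: algebra_simps)
  moreover have "e' * e = 1 \<or> e' * e = -1" using 1(1) 2(1) by auto
  ultimately show ?thesis unfolding congruent_sets_def by blast
qed

lemma sign_affine_isometry: "e = 1 \<or> e = -1 \<Longrightarrow> \<bar>(e * p + c) - (e * q + c)\<bar> = \<bar>p - q\<bar>"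
  for e c p q :: int
  by auto

lemma card_removable_congruent:
  assumes "congruent_sets S T"
  shows "card (removable D T) = card (removable D S)"
proof -
  obtain e c where e: "e = 1 \<or> e = -1" and T: "T = (\<lambda>x. e * x + c) ` S"
    using assms unfolding congruent_sets_def by blast
  have "removable D T = (\<lambda>x. e * x + c) ` removable D S"
    unfolding T by (rule removable_image) (rule sign_affine_isometry[OF e])
  moreover have "inj_on (\<lambda>x. e * x + c) (removable D S)" using e by (auto simp: inj_on_def)
  ultimately show ?thesis by (simp add: card_image)
qed

text \<open>
  An isometry from \<open>S\<close> to \<open>T\<close> carries removable points to removable points. If it does not send
  \<open>p\<close> to \<open>q\<close> itself, it does so after the reflection of \<open>S\<close> that exchanges its two removable
  points.
\<close>

lemma congruent_remove_removable:
  assumes "finite S" "congruent_sets S T" "p \<in> removable D S" "q \<in> removable D T"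
  shows "congruent_sets (S - {p}) (T - {q})"
proof -
  obtain e c where e: "e = 1 \<or> e = -1" and T: "T = (\<lambda>x. e * x + c) ` S"
    using assms unfolding congruent_sets_def by blast
  define g where "g = (\<lambda>x. e * x + c)"
  have Tg: "T = g ` S" by (simp add: T g_def)
  have inj: "inj g" using e by (auto simp: g_def inj_on_def)
  have "removable D T = g ` removable D S"
    unfolding T g_def by (rule removable_image) (rule sign_affine_isometry[OF e])
  then obtain r where r: "r \<in> removable D S" "q = g r" using assms(4) by blast
  have "T - {q} = g ` (S - {r})"
    using inj unfolding Tg r(2) by (auto simp: inj_def)
  then have rq: "congruent_sets (S - {r}) (T - {q})"
    using e unfolding congruent_sets_def g_def by blast
  show ?thesis
  proof (cases "p = r")
    case True
    then show ?thesis using rq by simp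
  next
    case False
    have "(-) (p + r) ` S = S"
      by (rule two_removable_reflection[OF assms(1,3) r(1) False])
    then have "S - {r} = (-) (p + r) ` S - {(-) (p + r) p}" by simp
    also have "\<dots> = (-) (p + r) ` (S - {p})" by auto
    also have "\<dots> = (\<lambda>x. (-1) * x + (p + r)) ` (S - {p})" by simp
    finally have "congruent_sets (S - {p}) (S - {r})" unfolding congruent_sets_def by blast
    then show ?thesis using rq congruent_sets_trans by blast
  qed
qed

text \<open>
  A vertex with star set \<open>S\<close> has two children, whose star sets are translates of each other if
  \<open>b\<close> holds (label 0) and are not otherwise (label 1).
\<close>

definition branches :: "bool \<Rightarrow> nat multiset \<Rightarrow> int set \<Rightarrow> bool" where
  "branches b D S \<longleftrightarrow> (\<exists>p q. p \<noteq> q \<and> removable D S = {p, q} \<and>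
     (translates (S - {p}) (S - {q}) \<longleftrightarrow> b))"

lemma branches_congruent:
  assumes "congruent_sets S T" "branches b D S"
  shows "branches b D T"
proof -
  obtain e c where e: "e = 1 \<or> e = -1" and T: "T = (\<lambda>x. e * x + c) ` S"
    using assms unfolding congruent_sets_def by blast
  define g where "g = (\<lambda>x. e * x + c)"
  have Tg: "T = g ` S" by (simp add: T g_def)
  have inj: "inj g" using e by (auto simp: g_def inj_on_def)
  obtain p q where pq: "p \<noteq> q" "removable D S = {p, q}"
    "translates (S - {p}) (S - {q}) \<longleftrightarrow> b"
    using assms(2) unfolding branches_def by blast
  have "removable D T = g ` removable D S"
    unfolding T g_def by (rule removable_image) (rule sign_affine_isometry[OF e])
  then have rem: "removable D T = {g p, g q}" by (simp add: pq(2))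
  have diff: "T - {g r} = g ` (S - {r})" for r
    using inj unfolding Tg by (auto simp: inj_def)
  have "(g ` B = (+) (e * d) ` g ` A) = (B = (+) d ` A)" for A B d
  proof -
    have "(+) (e * d) ` g ` A = g ` (+) d ` A"
      unfolding image_image by (intro image_cong) (auto simp: g_def algebra_simps)
    then show ?thesis using inj by (simp add: inj_image_eq_iff)
  qed
  then have "translates (g ` A) (g ` B) \<longleftrightarrow> translates A B" for A B
    unfolding translates_def using e
    by (metis (no_types, opaque_lifting) minus_mult_minus mult.left_neutral mult_1_left)
  then have "translates (T - {g p}) (T - {g q}) \<longleftrightarrow> b" using pq(3) by (simp add: diff)
  moreover have "g p \<noteq> g q" using pq(1) inj by (simp add: inj_eq)
  ultimately show ?thesis using rem unfolding branches_def by blast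
qed

lemma branches_iff:
  assumes "removable D S = {p, q}" "p \<noteq> q"
  shows "branches b D S \<longleftrightarrow> (translates (S - {p}) (S - {q}) \<longleftrightarrow> b)"
  using assms unfolding branches_def by (metis doubleton_eq_iff translates_sym)

lemma card_removable:
  assumes "finite S" "p \<in> removable D S"
  shows "card (removable D S) = (if branches True D S \<or> branches False D S then 2 else 1)"
proof (cases "removable D S = {p}")
  case True
  then show ?thesis by (auto simp: branches_def)
next
  case False
  then obtain q where "q \<in> removable D S" "q \<noteq> p" using assms(2) by blast
  then have "removable D S = {p, q}" "p \<noteq> q" using removable_two_eq[OF assms] by blast+
  then show ?thesis using branches_iff[of D S p q] by auto
qed

text \<open>
  The removable points of \<open>T\<close> are those of \<open>S\<close> shifted. The image of \<open>p\<close> always qualifies; a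
  second point does precisely when its removal from \<open>S\<close> leaves a translate of \<open>S - {p}\<close>.
\<close>

lemma card_translating_removals:
  assumes "finite S" "translates S T" "p \<in> removable D S"
  shows "card {q \<in> removable D T. translates (S - {p}) (T - {q})}
       = (if branches True D S then 2 else 1)"
proof -
  obtain c where T: "T = (+) c ` S" using assms(2) unfolding translates_def by blast
  have rem: "removable D T = (+) c ` removable D S" unfolding T by (rule removable_image) simp
  have diff: "T - {c + r} = (+) c ` (S - {r})" for r by (auto simp: T)
  have tr: "translates (S - {p}) (T - {c + r}) \<longleftrightarrow> translates (S - {p}) (S - {r})" for r
  proof -
    have "translates (S - {r}) (T - {c + r})" unfolding diff translates_def by blast
    then show ?thesis using translates_trans translates_sym by blast
  qed
  have "{q \<in> removable D T. translates (S - {p}) (T - {q})}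
      = (+) c ` {r \<in> removable D S. translates (S - {p}) (S - {r})}"
    using tr by (auto simp: rem)
  then have card_eq: "card {q \<in> removable D T. translates (S - {p}) (T - {q})}
      = card {r \<in> removable D S. translates (S - {p}) (S - {r})}"
    by (simp add: card_image)
  show ?thesis
  proof (cases "removable D S = {p}")
    case True
    have "{r \<in> removable D S. translates (S - {p}) (S - {r})} = {p}"
      using True translates_refl by auto
    moreover have "\<not> branches True D S" using True by (auto simp: branches_def)
    ultimately show ?thesis by (simp add: card_eq)
  next
    case False
    then obtain q where "q \<in> removable D S" "q \<noteq> p" using assms(3) by blast
    then have pq: "removable D S = {p, q}" "p \<noteq> q"
      using removable_two_eq[OF assms(1,3)] by blast+
    show ?thesis
    proof (cases "translates (S - {p}) (S - {q})")
      case True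
      then have "{r \<in> removable D S. translates (S - {p}) (S - {r})} = {p, q}"
        using pq translates_refl by auto
      then show ?thesis using True pq branches_iff[OF pq] by (simp add: card_eq)
    next
      case False
      then have "{r \<in> removable D S. translates (S - {p}) (S - {r})} = {p}"
        using pq translates_refl by auto
      then show ?thesis using False pq branches_iff[OF pq] by (simp add: card_eq)
    qed
  qed
qed

text \<open>
  Ordered pairs, including the diagonal: then a product of sets is summed over and every
  distance between two distinct points is counted twice.
\<close>

definition pair_dists :: "int set \<Rightarrow> nat multiset" where
  "pair_dists S = image_mset (\<lambda>x. nat \<bar>fst x - snd x\<bar>) (mset_set (S \<times> S))"

lemma pair_dists_translates:
  assumes "translates S T" shows "pair_dists S = pair_dists T"
proof -
  obtain c where T: "T = (+) c ` S" using assms unfolding translates_def by blast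
  have "T \<times> T = map_prod ((+) c) ((+) c) ` (S \<times> S)" by (auto simp: T)
  moreover have "inj_on (map_prod ((+) c) ((+) c)) (S \<times> S)" by (auto simp: inj_on_def)
  ultimately have "mset_set (T \<times> T) = image_mset (map_prod ((+) c) ((+) c)) (mset_set (S \<times> S))"
    by (simp add: image_mset_mset_set)
  then show ?thesis
    by (simp add: pair_dists_def multiset.map_comp o_def case_prod_beta)
qed

lemma pair_dists_remove:
  assumes "finite S" "p \<in> S"
  shows "pair_dists S = add_mset 0 (pair_dists (S - {p}) + dists p (S - {p}) + dists p (S - {p}))"
proof -
  let ?R = "S - {p}"
  let ?P = "Pair p ` ?R" and ?Q = "(\<lambda>a. (a, p)) ` ?R"
  have "S \<times> S = insert (p, p) ((?R \<times> ?R \<union> ?P) \<union> ?Q)" using assms(2) by auto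
  also have "mset_set \<dots> = add_mset (p, p) (mset_set ((?R \<times> ?R \<union> ?P) \<union> ?Q))"
    using assms(1) by (intro mset_set.insert) auto
  also have "mset_set ((?R \<times> ?R \<union> ?P) \<union> ?Q) = mset_set (?R \<times> ?R \<union> ?P) + mset_set ?Q"
    using assms(1) by (intro mset_set_Union) auto
  also have "mset_set (?R \<times> ?R \<union> ?P) = mset_set (?R \<times> ?R) + mset_set ?P"
    using assms(1) by (intro mset_set_Union) auto
  also have "mset_set ?P = image_mset (Pair p) (mset_set ?R)"
    by (simp add: image_mset_mset_set inj_on_def)
  also have "mset_set ?Q = image_mset (\<lambda>a. (a, p)) (mset_set ?R)"
    by (simp add: image_mset_mset_set inj_on_def)
  finally show ?thesis
    by (simp add: pair_dists_def dists_def multiset.map_comp o_def abs_minus_commute)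
qed

text \<open>
  Apart from the diagonal pair of \<open>p\<close>, the distances from \<open>p\<close> are half of what \<open>pair_dists\<close>
  loses when \<open>p\<close> is removed, and \<open>pair_dists\<close> is the same for translates.
\<close>

lemma dists_eq_if_translates:
  assumes "finite S" "finite T" "p \<in> S" "q \<in> T"
    and "translates S T" "translates (S - {p}) (T - {q})"
  shows "dists p (S - {p}) = dists q (T - {q})"
proof -
  have "add_mset 0 (pair_dists (T - {q}) + dists p (S - {p}) + dists p (S - {p}))
      = add_mset 0 (pair_dists (T - {q}) + dists q (T - {q}) + dists q (T - {q}))"
    using pair_dists_remove[OF assms(1,3)] pair_dists_remove[OF assms(2,4)]
      pair_dists_translates[OF assms(5)] pair_dists_translates[OF assms(6)] by simp
  then have "dists p (S - {p}) + dists p (S - {p}) = dists q (T - {q}) + dists q (T - {q})"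
    by simp
  then have "count (dists p (S - {p})) d + count (dists p (S - {p})) d
      = count (dists q (T - {q})) d + count (dists q (T - {q})) d" for d
    by (metis count_union)
  then show ?thesis by (intro multiset_eqI) (metis add_self_div_2)
qed

section \<open>Sumsets and translation classes\<close>

definition sumset :: "int set \<Rightarrow> int set \<Rightarrow> int set" where
  "sumset A E = (\<Union>e\<in>E. (+) e ` A)"

lemma in_sumset: "p \<in> sumset A E \<longleftrightarrow> (\<exists>x\<in>A. p - x \<in> E)"
proof
  assume "\<exists>x\<in>A. p - x \<in> E"
  then obtain x where "x \<in> A" "p - x \<in> E" by blast
  moreover have "p = (p - x) + x" by simp
  ultimately show "p \<in> sumset A E" unfolding sumset_def by blast
next
  assume "p \<in> sumset A E"
  then obtain e x where "e \<in> E" "x \<in> A" "p = e + x" unfolding sumset_def by blast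
  then show "\<exists>x\<in>A. p - x \<in> E" by (intro bexI[of _ x]) auto
qed

lemma finite_sumset: "finite A \<Longrightarrow> finite E \<Longrightarrow> finite (sumset A E)"
  by (simp add: sumset_def)

lemma card_sumset_shift_left: "card (sumset ((+) c ` A) E) = card (sumset A E)"
proof -
  have "sumset ((+) c ` A) E = (+) c ` sumset A E"
    unfolding sumset_def image_UN image_image by (simp add: algebra_simps)
  then show ?thesis by (simp add: card_image)
qed

lemma card_sumset_shift_right: "card (sumset A ((+) c ` E)) = card (sumset A E)"
proof -
  have "sumset A ((+) c ` E) = (+) c ` sumset A E"
    unfolding sumset_def image_UN image_image by (simp add: algebra_simps)
  then show ?thesis by (simp add: card_image)
qed

lemma card_sumset_translates: "translates A B \<Longrightarrow> card (sumset A E) = card (sumset B E)"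
  unfolding translates_def by (auto simp: card_sumset_shift_left)

text \<open>
  Without the condition \<open>A \<noteq> {}\<close> every \<open>p\<close> would qualify for the empty set; with it,
  \<open>card_sumset_punctured_interval\<close> holds for empty \<open>A\<close> too.
\<close>

definition mirror_fits :: "int set \<Rightarrow> int set \<Rightarrow> int set" where
  "mirror_fits A F = {p. A \<noteq> {} \<and> (\<forall>x\<in>A. p - x \<in> F)}"

lemma finite_mirror_fits:
  assumes "finite F" shows "finite (mirror_fits A F)"
proof (cases "A = {}")
  case False
  then obtain x where "x \<in> A" by blast
  have "mirror_fits A F \<subseteq> (+) x ` F"
  proof
    fix p assume "p \<in> mirror_fits A F"
    then have "p - x \<in> F" using \<open>x \<in> A\<close> by (simp add: mirror_fits_def)
    then show "p \<in> (+) x ` F" by (rule rev_image_eqI) simp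
  qed
  then show ?thesis using assms finite_subset by blast
qed (simp add: mirror_fits_def)

lemma card_mirror_fits_translates:
  assumes "translates A B" shows "card (mirror_fits A F) = card (mirror_fits B F)"
proof -
  obtain c where B: "B = (+) c ` A" using assms unfolding translates_def by blast
  have "p \<in> (+) c ` mirror_fits A F" if "p \<in> mirror_fits B F" for p
    using that by (intro image_eqI[of _ _ "p - c"]) (auto simp: mirror_fits_def B algebra_simps)
  then have "mirror_fits B F = (+) c ` mirror_fits A F"
    by (auto simp: mirror_fits_def B)
  then show ?thesis by (simp add: card_image)
qed

text \<open>
  A point \<open>p\<close> is missed by \<open>A + ([-N, N] - F)\<close> but covered by \<open>A + [-N, N]\<close> iff \<open>p - A\<close> meets
  \<open>[-N, N]\<close> inside \<open>F\<close> only. As \<open>N\<close> is large compared with \<open>F\<close> and the width of \<open>A\<close>, all of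
  \<open>p - A\<close> then lies in \<open>[-N, N]\<close>, hence in \<open>F\<close>.
\<close>

lemma card_sumset_punctured_interval:
  assumes A: "A \<subseteq> {0..w}" and F: "F \<subseteq> {-K..K}" and N: "K + w \<le> N"
  shows "card (sumset A {-N..N}) = card (sumset A ({-N..N} - F)) + card (mirror_fits A F)"
proof -
  have fin: "finite A" "finite F" using A F finite_subset by blast+
  have "sumset A {-N..N} = sumset A ({-N..N} - F) \<union> mirror_fits A F"
  proof (intro set_eqI iffI)
    fix p assume "p \<in> sumset A {-N..N}"
    then obtain x where x: "x \<in> A" "p - x \<in> {-N..N}" unfolding in_sumset by blast
    show "p \<in> sumset A ({-N..N} - F) \<union> mirror_fits A F"
    proof (cases "p \<in> sumset A ({-N..N} - F)")
      case False
      then have miss: "p - y \<in> F" if "y \<in> A" "p - y \<in> {-N..N}" for y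
        using that unfolding in_sumset by blast
      have "p - y \<in> F" if y: "y \<in> A" for y
      proof (rule miss[OF y])
        have "p - x \<in> {-K..K}" using miss x F by blast
        moreover have "x \<in> {0..w}" "y \<in> {0..w}" using x y A by blast+
        ultimately show "p - y \<in> {-N..N}" using N by auto
      qed
      then show ?thesis using x by (auto simp: mirror_fits_def)
    qed simp
  next
    fix p assume p: "p \<in> sumset A ({-N..N} - F) \<union> mirror_fits A F"
    show "p \<in> sumset A {-N..N}"
    proof (cases "p \<in> mirror_fits A F")
      case True
      then obtain x where x: "x \<in> A" "p - x \<in> F" by (auto simp: mirror_fits_def)
      moreover have "0 \<le> w" using A x by auto
      ultimately have "p - x \<in> {-N..N}" using F N by fastforce
      then show ?thesis using x unfolding in_sumset by blast
    qed (use p in \<open>auto simp: in_sumset\<close>)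
  qed
  moreover have "sumset A ({-N..N} - F) \<inter> mirror_fits A F = {}"
    by (auto simp: in_sumset mirror_fits_def)
  ultimately show ?thesis
    using fin by (simp add: card_Un_disjoint finite_sumset finite_mirror_fits)
qed

lemma card_sumset_interval_bounds:
  assumes A: "A \<subseteq> {0..w}" and ne: "A \<noteq> {}" and N: "0 \<le> N"
  shows "N \<le> int (card (sumset A {0..<N}))" "int (card (sumset A {0..<N})) \<le> N + w"
proof -
  obtain x where x: "x \<in> A" using ne by blast
  have fin: "finite (sumset A {0..<N})"
    using A by (meson finite_sumset finite_atLeastAtMost_int finite_atLeastLessThan_int finite_subset)
  have "(+) x ` {0..<N} \<subseteq> sumset A {0..<N}" using x by (auto simp: in_sumset intro!: bexI[of _ x])
  then have "card ((+) x ` {0..<N}) \<le> card (sumset A {0..<N})" by (rule card_mono[OF fin])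
  then show "N \<le> int (card (sumset A {0..<N}))" by (simp add: card_image)
  have "sumset A {0..<N} \<subseteq> {0..<N + w}" using A by (force simp: in_sumset)
  then have "card (sumset A {0..<N}) \<le> card {0..<N + w}" by (intro card_mono) auto
  moreover have "0 \<le> w" using A x by auto
  ultimately show "int (card (sumset A {0..<N})) \<le> N + w" using N by simp
qed

text \<open>
  Adding an interval of length \<open>N\<close> to a nonempty set gives \<open>N\<close> points up to a bounded error, so
  for large \<open>N\<close> the sums determine how many sets of a family are nonempty.
\<close>

lemma decreasing_families_nonempty:
  fixes A B :: "nat \<Rightarrow> int set"
  assumes decA: "\<And>s t. s \<le> t \<Longrightarrow> A t \<subseteq> A s" and decB: "\<And>s t. s \<le> t \<Longrightarrow> B t \<subseteq> B s"
    and bndA: "\<And>t. A t \<subseteq> {0..w}" and bndB: "\<And>t. B t \<subseteq> {0..w}"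
    and eq: "\<And>E. finite E \<Longrightarrow> (\<Sum>t\<in>{1..M}. card (sumset (A t) E)) = (\<Sum>t\<in>{1..M}. card (sumset (B t) E))"
    and t: "t \<in> {1..M}" and ne: "B t \<noteq> {}"
  shows "A t \<noteq> {}"
proof
  assume empty: "A t = {}"
  have w: "0 \<le> w" using bndB[of t] ne by fastforce
  \<comment> \<open>\<open>N\<close> is large enough that \<open>t\<close> sumsets of size at least \<open>N\<close> outweigh \<open>t - 1\<close> of size at most \<open>N + w\<close>.\<close>
  define N where "N = int t * w + 1"
  have N: "0 \<le> N" using w by (simp add: N_def)
  have "int t * N = (\<Sum>s\<in>{1..t}. N)" by simp
  also have "\<dots> \<le> (\<Sum>s\<in>{1..t}. int (card (sumset (B s) {0..<N})))"
  proof (intro sum_mono card_sumset_interval_bounds(1)[OF bndB _ N])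
    fix s assume "s \<in> {1..t}"
    then show "B s \<noteq> {}" using ne decB[of s t] by auto
  qed
  also have "\<dots> \<le> (\<Sum>s\<in>{1..M}. int (card (sumset (B s) {0..<N})))"
    using t by (intro sum_mono2) auto
  also have "\<dots> = (\<Sum>s\<in>{1..M}. int (card (sumset (A s) {0..<N})))"
    using eq[of "{0..<N}"] by (simp flip: of_nat_sum)
  also have "\<dots> = (\<Sum>s\<in>{1..<t}. int (card (sumset (A s) {0..<N})))"
  proof (intro sum.mono_neutral_right ballI)
    fix s assume "s \<in> {1..M} - {1..<t}"
    then have "A s = {}" using decA[of t s] empty by auto
    then show "int (card (sumset (A s) {0..<N})) = 0" by (simp add: sumset_def)
  qed (use t in auto)
  also have "\<dots> \<le> (\<Sum>s\<in>{1..<t}. N + w)"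
  proof (intro sum_mono)
    fix s
    show "int (card (sumset (A s) {0..<N})) \<le> N + w"
      using card_sumset_interval_bounds(2)[OF bndA _ N, of s] N w
      by (cases "A s = {}") (auto simp: sumset_def)
  qed
  also have "\<dots> = (int t - 1) * (N + w)" using t by (simp add: of_nat_diff)
  finally have "N \<le> (int t - 1) * w" by (simp add: algebra_simps)
  then show False using w by (simp add: N_def algebra_simps)
qed

text \<open>
  By the punctured interval formula the hypothesis says that for every finite \<open>F\<close> equally many
  mirrored translates of the \<open>A t\<close> and of the \<open>B t\<close> fit into \<open>F\<close>. Consider the largest \<open>t\<close> with
  \<open>A t\<close>, \<open>B t\<close> not translates, and let \<open>C\<close> be the family whose \<open>t\<close>-th set is not larger than
  that of the other family \<open>D\<close>. For \<open>F = - C t\<close>, indices above \<open>t\<close> contribute equally, the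
  index \<open>t\<close> contributes to \<open>C\<close>, and the sets \<open>D s\<close> with \<open>s \<le> t\<close> contribute nothing: they are
  too large to fit unless \<open>D s = D t\<close> is a translate of \<open>C t\<close>.
\<close>

theorem decreasing_families_translates:
  fixes A B :: "nat \<Rightarrow> int set"
  assumes decA: "\<And>s t. s \<le> t \<Longrightarrow> A t \<subseteq> A s" and decB: "\<And>s t. s \<le> t \<Longrightarrow> B t \<subseteq> B s"
    and bndA: "\<And>t. A t \<subseteq> {0..w}" and bndB: "\<And>t. B t \<subseteq> {0..w}"
    and eq: "\<And>E. finite E \<Longrightarrow> (\<Sum>t\<in>{1..M}. card (sumset (A t) E)) = (\<Sum>t\<in>{1..M}. card (sumset (B t) E))"
    and t: "t \<in> {1..M}"
  shows "translates (A t) (B t)"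
proof -
  have fits_eq: "(\<Sum>t\<in>{1..M}. card (mirror_fits (A t) F)) = (\<Sum>t\<in>{1..M}. card (mirror_fits (B t) F))"
    if F: "finite F" for F
  proof -
    obtain K where K: "F \<subseteq> {-K..K}"
    proof -
      have "F \<subseteq> {- (\<Sum>x\<in>F. \<bar>x\<bar>)..(\<Sum>x\<in>F. \<bar>x\<bar>)}"
      proof
        fix x assume "x \<in> F"
        then have "\<bar>x\<bar> \<le> (\<Sum>x\<in>F. \<bar>x\<bar>)" using F by (intro member_le_sum) auto
        then show "x \<in> {- (\<Sum>x\<in>F. \<bar>x\<bar>)..(\<Sum>x\<in>F. \<bar>x\<bar>)}" by auto
      qed
      then show ?thesis by (rule that)
    qed
    let ?J = "{-(K + w)..K + w}"
    have "(\<Sum>t\<in>{1..M}. card (sumset (C t) ?J))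
        = (\<Sum>t\<in>{1..M}. card (sumset (C t) (?J - F))) + (\<Sum>t\<in>{1..M}. card (mirror_fits (C t) F))"
      if "\<And>t. C t \<subseteq> {0..w}" for C :: "nat \<Rightarrow> int set"
      unfolding sum.distrib[symmetric]
      by (intro sum.cong refl card_sumset_punctured_interval[OF that K]) simp
    from this[of A, OF bndA] this[of B, OF bndB] eq[of ?J] eq[of "?J - F"]
    show ?thesis by simp
  qed
  \<comment> \<open>At the largest bad index either set would have to be strictly smaller than the other; stating this
    for families \<open>C\<close>, \<open>D\<close> allows it to be used in both directions.\<close>
  have main: "card (D t) < card (C t)"
    if decC: "\<And>s t. s \<le> t \<Longrightarrow> C t \<subseteq> C s" and decD: "\<And>s t. s \<le> t \<Longrightarrow> D t \<subseteq> D s"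
      and finC: "\<And>s. finite (C s)" and finD: "\<And>s. finite (D s)"
      and fits: "\<And>F. finite F \<Longrightarrow> (\<Sum>t\<in>{1..M}. card (mirror_fits (C t) F)) = (\<Sum>t\<in>{1..M}. card (mirror_fits (D t) F))"
      and t: "t \<in> {1..M}" and ne: "C t \<noteq> {}"
      and bad: "\<not> translates (C t) (D t)"
      and later: "\<And>s. s \<in> {1..M} \<Longrightarrow> t < s \<Longrightarrow> translates (C s) (D s)"
    for C D :: "nat \<Rightarrow> int set" and t
  proof (rule ccontr)
    assume "\<not> card (D t) < card (C t)"
    then have le: "card (C t) \<le> card (D t)" by simp
    define F where "F = uminus ` C t"
    have finF: "finite F" using finC by (simp add: F_def)
    have D0: "mirror_fits (D s) F = {}" if s: "s \<in> {1..t}" for s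
    proof (rule ccontr)
      assume "mirror_fits (D s) F \<noteq> {}"
      then obtain p where "\<forall>x\<in>D s. p - x \<in> F" by (auto simp: mirror_fits_def)
      then have sub: "(\<lambda>x. x - p) ` D s \<subseteq> C t"
        by (auto simp: F_def) (metis (no_types, lifting) imageE minus_diff_eq minus_minus)
      have card_s: "card ((\<lambda>x. x - p) ` D s) = card (D s)"
        by (intro card_image) (auto simp: inj_on_def)
      have st: "card (D t) \<le> card (D s)" using s decD[of s t] finD by (intro card_mono) auto
      have "card (D s) \<le> card (C t)" using card_mono[OF finC sub] card_s by simp
      then have "card (D s) = card (D t)" "card (D s) = card (C t)" using st le by simp_all
      moreover from this have "D t = D s" using s decD[of s t] finD by (intro card_subset_eq) auto
      moreover have "(\<lambda>x. x - p) ` D s = C t"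
        using calculation(2) sub card_s finC by (intro card_subset_eq) auto
      ultimately have "C t = (+) (- p) ` D t" by simp
      then show False using bad translates_sym unfolding translates_def by blast
    qed
    have "(\<Sum>s\<in>{1..M}. card (mirror_fits (D s) F)) = (\<Sum>s\<in>{t<..M}. card (mirror_fits (D s) F))"
      by (intro sum.mono_neutral_right) (use D0 t in auto)
    also have "\<dots> = (\<Sum>s\<in>{t<..M}. card (mirror_fits (C s) F))"
      by (intro sum.cong refl card_mirror_fits_translates[symmetric] later) (use t in auto)
    also have "\<dots> < card (mirror_fits (C t) F) + \<dots>"
    proof -
      have "0 \<in> mirror_fits (C t) F" using ne by (auto simp: mirror_fits_def F_def)
      then have "card (mirror_fits (C t) F) \<noteq> 0" using finite_mirror_fits[OF finF] by auto
      then show ?thesis by simp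
    qed
    also have "\<dots> = (\<Sum>s\<in>insert t {t<..M}. card (mirror_fits (C s) F))" by simp
    also have "\<dots> \<le> (\<Sum>s\<in>{1..M}. card (mirror_fits (C s) F))"
      using t by (intro sum_mono2) auto
    finally show False using fits[OF finF] by simp
  qed
  have finA: "finite (A s)" and finB: "finite (B s)" for s
    using bndA[of s] bndB[of s] finite_subset by blast+
  show ?thesis
  proof (rule ccontr)
    define T where "T = {t \<in> {1..M}. \<not> translates (A t) (B t)}"
    assume "\<not> translates (A t) (B t)"
    then have "T \<noteq> {}" using t by (auto simp: T_def)
    moreover have finT: "finite T" by (simp add: T_def)
    ultimately have max: "Max T \<in> T" by (rule Max_in[rotated])
    define m where "m = Max T"
    have m: "m \<in> {1..M}" "\<not> translates (A m) (B m)" using max by (auto simp: m_def T_def)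
    have later: "translates (A s) (B s)" if "s \<in> {1..M}" "m < s" for s
      using that Max_ge[OF finT, of s] unfolding m_def T_def by fastforce
    have "A m \<noteq> {}" if "B m \<noteq> {}"
      by (rule decreasing_families_nonempty[of A B, OF decA decB bndA bndB eq m(1) that])
    moreover have "B m \<noteq> {}" if "A m \<noteq> {}"
      by (rule decreasing_families_nonempty[of B A, OF decB decA bndB bndA eq[symmetric] m(1) that])
    ultimately have "A m \<noteq> {}" "B m \<noteq> {}" using m(2) translates_refl by metis+
    then show False
      using main[of A B m, OF decA decB finA finB fits_eq m(1) _ m(2) later]
        main[of B A m, OF decB decA finB finA fits_eq[symmetric] m(1)] m(2) later translates_sym
      by (metis less_asym)
  qed
qed

section \<open>Super-strong Wilf equivalence and level sets\<close>

definition level_set :: "nat list \<Rightarrow> nat \<Rightarrow> int set" where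
  "level_set u t = int ` {k. k < length u \<and> t \<le> u ! k}"

lemma finite_level_set: "finite (level_set u t)"
  by (simp add: level_set_def)

lemma level_set_antimono: "s \<le> t \<Longrightarrow> level_set u t \<subseteq> level_set u s"
  by (auto simp: level_set_def)

lemma level_set_bounds: "level_set u t \<subseteq> {0..int (length u)}"
  by (auto simp: level_set_def)

lemma level_set_empty: "\<forall>a\<in>set u. a < t \<Longrightarrow> level_set u t = {}"
  using nth_mem by (fastforce simp: level_set_def)

lemma level_set_pos_word:
  "u \<in> pos_words \<Longrightarrow> t \<le> 1 \<Longrightarrow> level_set u t = int ` {..<length u}"
proof -
  assume "u \<in> pos_words" "t \<le> 1"
  then have "t \<le> u ! k" if "k < length u" for k
    using that nth_mem[OF that] unfolding pos_words_def by (blast intro: order_trans)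
  then have "{k. k < length u \<and> t \<le> u ! k} = {..<length u}" by auto
  then show ?thesis by (simp add: level_set_def)
qed

text \<open>
  Zero-based embedding places: those of \<open>Em\<close> lowered by one.
\<close>

definition embeddings :: "nat list \<Rightarrow> nat list \<Rightarrow> nat set" where
  "embeddings u w = {e. e + length u \<le> length w \<and> (\<forall>i<length u. u ! i \<le> w ! (e + i))}"

lemma Em_eq_embeddings: "Em u w = Suc ` embeddings u w"
proof (intro set_eqI iffI)
  fix j assume j: "j \<in> Em u w"
  then obtain e where e: "j = Suc e" unfolding Em_def by (cases j) auto
  have "u ! i \<le> w ! (e + i)" if "i < length u" for i
    using j that unfolding Em_def e by (auto dest!: bspec[of _ _ "Suc i"])
  then show "j \<in> Suc ` embeddings u w" using j unfolding Em_def e embeddings_def by auto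
next
  fix j assume "j \<in> Suc ` embeddings u w"
  then obtain e where e: "j = Suc e" "e \<in> embeddings u w" by blast
  have "u ! (i - 1) \<le> w ! (j + i - 1 - 1)" if "i \<in> {1..length u}" for i
    using e(2) that by (cases i) (auto simp: embeddings_def e(1))
  then show "j \<in> Em u w" using e by (auto simp: Em_def embeddings_def)
qed

lemma Em_eq_iff: "Em u w = Em v w' \<longleftrightarrow> embeddings u w = embeddings v w'"
  unfolding Em_eq_embeddings by (simp add: inj_image_eq_iff)

lemma embeddings_bound: "embeddings u w \<subseteq> {e. e + length u \<le> length w}"
  by (auto simp: embeddings_def)

text \<open>
  If the copies of \<open>u\<close> at the places in \<open>E\<close> fit into length \<open>L\<close>, this is the pointwise smallest
  word of that length over the positive integers in which \<open>u\<close> embeds at all of them. The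
  inserted 1 is the letter at positions that no copy of \<open>u\<close> covers.
\<close>

definition cluster :: "nat list \<Rightarrow> nat set \<Rightarrow> nat \<Rightarrow> nat list" where
  "cluster u E L =
    map (\<lambda>p. Max (insert 1 ((\<lambda>e. u ! (p - e)) ` {e \<in> E. e \<le> p \<and> p - e < length u}))) [0..<L]"

lemma length_cluster [simp]: "length (cluster u E L) = L"
  by (simp add: cluster_def)

lemma cluster_le_iff:
  assumes "p < L"
  shows "cluster u E L ! p \<le> m \<longleftrightarrow>
    1 \<le> m \<and> (\<forall>e\<in>E. e \<le> p \<longrightarrow> p - e < length u \<longrightarrow> u ! (p - e) \<le> m)"
  using assms by (auto simp: cluster_def)

lemma le_cluster_iff:
  assumes "p < L" "2 \<le> t"
  shows "t \<le> cluster u E L ! p \<longleftrightarrow> (\<exists>e\<in>E. e \<le> p \<and> p - e < length u \<and> t \<le> u ! (p - e))"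
  using assms by (auto simp: cluster_def Max_ge_iff)

lemma cluster_pos_word: "cluster u E L \<in> pos_words"
  unfolding pos_words_def
proof (intro CollectI ballI)
  fix a assume "a \<in> set (cluster u E L)"
  then obtain p where "p < L" "a = cluster u E L ! p" by (metis in_set_conv_nth length_cluster)
  then show "1 \<le> a" using cluster_le_iff[of p L u E a] by simp
qed

lemma embeddings_superset_iff:
  assumes E: "E \<subseteq> {e. e + length u \<le> L}" and w: "w \<in> pos_words" "length w = L"
  shows "E \<subseteq> embeddings u w \<longleftrightarrow> (\<forall>p<L. cluster u E L ! p \<le> w ! p)"
proof -
  have pos: "1 \<le> w ! p" if "p < L" for p using w that by (auto simp: pos_words_def)
  have "E \<subseteq> embeddings u w \<longleftrightarrow> (\<forall>e\<in>E. \<forall>i<length u. u ! i \<le> w ! (e + i))"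
    using E w(2) by (auto simp: embeddings_def)
  also have "\<dots> \<longleftrightarrow> (\<forall>p<L. \<forall>e\<in>E. e \<le> p \<longrightarrow> p - e < length u \<longrightarrow> u ! (p - e) \<le> w ! p)"
  proof (intro iffI allI ballI impI)
    fix e i assume *: "\<forall>p<L. \<forall>e\<in>E. e \<le> p \<longrightarrow> p - e < length u \<longrightarrow> u ! (p - e) \<le> w ! p"
      and e: "e \<in> E" and i: "i < length u"
    have "e + i < L" using e i E by auto
    then show "u ! i \<le> w ! (e + i)" using *[rule_format, of "e + i" e] e i by simp
  next
    fix p e assume *: "\<forall>e\<in>E. \<forall>i<length u. u ! i \<le> w ! (e + i)"
      and "e \<in> E" "e \<le> p" "p - e < length u"
    then show "u ! (p - e) \<le> w ! p" using *[rule_format, of e "p - e"] by simp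
  qed
  also have "\<dots> \<longleftrightarrow> (\<forall>p<L. cluster u E L ! p \<le> w ! p)"
    using pos by (simp add: cluster_le_iff)
  finally show ?thesis .
qed

lemma sum_list_levels:
  assumes "\<forall>a\<in>set xs. a \<le> M"
  shows "sum_list xs = (\<Sum>t\<in>{1..M}. card {p. p < length xs \<and> t \<le> xs ! p})"
proof -
  have "sum_list xs = (\<Sum>p<length xs. xs ! p)" by (simp add: sum_list_sum_nth atLeast0LessThan)
  also have "\<dots> = (\<Sum>p<length xs. \<Sum>t\<in>{1..M}. of_bool (t \<le> xs ! p))"
  proof (intro sum.cong refl)
    fix p assume "p \<in> {..<length xs}"
    then have "xs ! p \<le> M" using assms by auto
    then have "{1..M} \<inter> {t. t \<le> xs ! p} = {1..xs ! p}" by auto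
    then show "xs ! p = (\<Sum>t\<in>{1..M}. of_bool (t \<le> xs ! p))" by (simp add: of_bool_def sum.If_cases)
  qed
  also have "\<dots> = (\<Sum>t\<in>{1..M}. \<Sum>p<length xs. of_bool (t \<le> xs ! p))" by (rule sum.swap)
  also have "\<dots> = (\<Sum>t\<in>{1..M}. card {p. p < length xs \<and> t \<le> xs ! p})"
    by (intro sum.cong refl) (simp add: of_bool_def sum.If_cases lessThan_def Int_def)
  finally show ?thesis .
qed

text \<open>
  For \<open>t = 1\<close> the set on the left would be all of \<open>{..<L}\<close>, whether covered by a copy of \<open>u\<close> or
  not.
\<close>

lemma card_le_cluster:
  assumes E: "E \<subseteq> {e. e + length u \<le> L}" and t: "2 \<le> t"
  shows "card {p. p < L \<and> t \<le> cluster u E L ! p} = card (sumset (level_set u t) (int ` E))"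
proof -
  have "int ` {p. p < L \<and> t \<le> cluster u E L ! p} = sumset (level_set u t) (int ` E)"
  proof (intro set_eqI iffI)
    fix x assume "x \<in> int ` {p. p < L \<and> t \<le> cluster u E L ! p}"
    then obtain p where p: "x = int p" "p < L" "t \<le> cluster u E L ! p" by blast
    then obtain e where e: "e \<in> E" "e \<le> p" "p - e < length u" "t \<le> u ! (p - e)"
      using le_cluster_iff[OF p(2) t] by blast
    have "int (p - e) \<in> level_set u t" unfolding level_set_def using e by (intro imageI) simp
    moreover have "x - int (p - e) = int e" using p e by simp
    ultimately show "x \<in> sumset (level_set u t) (int ` E)" using e(1) unfolding in_sumset by auto
  next
    fix x assume "x \<in> sumset (level_set u t) (int ` E)"
    then obtain k e where k: "k < length u" "t \<le> u ! k" "e \<in> E" "x - int k = int e"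
      unfolding in_sumset level_set_def by blast
    have "x = int (e + k)" using k(4) by simp
    moreover have "e + k < L"
    proof -
      have "e + length u \<le> L" using E k(3) by blast
      then show ?thesis using k(1) by simp
    qed
    moreover have "t \<le> cluster u E L ! (e + k)"
      unfolding le_cluster_iff[OF \<open>e + k < L\<close> t] using k by (intro bexI[of _ e]) auto
    ultimately show "x \<in> int ` {p. p < L \<and> t \<le> cluster u E L ! p}" by blast
  qed
  moreover have "card (int ` {p. p < L \<and> t \<le> cluster u E L ! p})
      = card {p. p < L \<and> t \<le> cluster u E L ! p}"
    by (intro card_image inj_on_of_nat)
  ultimately show ?thesis by simp
qed

text \<open>
  The level \<open>t = 1\<close> contributes \<open>L\<close> to the height of the cluster but the size of
  \<open>{..<length u} + E\<close> to the sum on the right. Keeping this term on the left lets the formula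
  be compared for two words of the same length.
\<close>

lemma sum_list_cluster:
  assumes u: "u \<in> pos_words" and M: "1 \<le> M" "\<forall>a\<in>set u. a \<le> M"
    and E: "E \<subseteq> {e. e + length u \<le> L}"
  shows "sum_list (cluster u E L) + card (sumset (int ` {..<length u}) (int ` E))
    = L + (\<Sum>t\<in>{1..M}. card (sumset (level_set u t) (int ` E)))"
proof -
  have bnd: "\<forall>a\<in>set (cluster u E L). a \<le> M"
  proof
    fix a assume "a \<in> set (cluster u E L)"
    then obtain p where p: "p < L" "a = cluster u E L ! p" by (metis in_set_conv_nth length_cluster)
    then show "a \<le> M" using M by (simp add: cluster_le_iff)
  qed
  have split: "{1..M} = insert 1 {2..M}" using M(1) by auto
  have "{p. p < L \<and> 1 \<le> cluster u E L ! p} = {..<L}"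
    using cluster_pos_word[of u E L] unfolding pos_words_def
    by (auto simp: all_set_conv_all_nth)
  then have "sum_list (cluster u E L)
      = L + (\<Sum>t\<in>{2..M}. card (sumset (level_set u t) (int ` E)))"
    unfolding sum_list_levels[OF bnd] split using E by (simp add: card_le_cluster)
  then show ?thesis unfolding split by (simp add: level_set_pos_word[OF u])
qed

lemma super_strong_Wilf_sym: "(u, v) \<in> super_strong_Wilf \<Longrightarrow> (v, u) \<in> super_strong_Wilf"
proof -
  assume "(u, v) \<in> super_strong_Wilf"
  then obtain f where uv: "u \<in> pos_words" "v \<in> pos_words" and f: "bij_betw f pos_words pos_words"
    and *: "\<And>w. w \<in> pos_words \<Longrightarrow> length (f w) = length w \<and> sum_list (f w) = sum_list w \<and> Em u w = Em v (f w)"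
    unfolding super_strong_Wilf_def by blast
  define g where "g = the_inv_into pos_words f"
  have g: "bij_betw g pos_words pos_words" unfolding g_def by (rule bij_betw_the_inv_into[OF f])
  have "length (g w) = length w \<and> sum_list (g w) = sum_list w \<and> Em v w = Em u (g w)"
    if w: "w \<in> pos_words" for w
  proof -
    have "g w \<in> pos_words" using g w by (auto simp: bij_betw_def)
    moreover have "f (g w) = w" unfolding g_def
      using f w by (auto simp: bij_betw_def f_the_inv_into_f)
    ultimately show ?thesis using *[of "g w"] by simp
  qed
  then show "(v, u) \<in> super_strong_Wilf" unfolding super_strong_Wilf_def using uv g by blast
qed

lemma super_strong_Wilf_length_le:
  assumes "(u, v) \<in> super_strong_Wilf"
  shows "length v \<le> length u"
proof -
  obtain f where u: "u \<in> pos_words" and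
    f: "\<And>w. w \<in> pos_words \<Longrightarrow> length (f w) = length w \<and> Em u w = Em v (f w)"
    using assms unfolding super_strong_Wilf_def by blast
  have "0 \<in> embeddings u u" by (simp add: embeddings_def)
  then have "0 \<in> embeddings v (f u)" using f[OF u] Em_eq_iff[of u u v "f u"] by simp
  then show ?thesis using f[OF u] by (simp add: embeddings_def)
qed

text \<open>
  The image of the cluster of \<open>u\<close> under the bijection is a word of the same height in which \<open>v\<close>
  embeds at all places of \<open>E\<close>, hence it lies above the cluster of \<open>v\<close>.
\<close>

lemma super_strong_Wilf_cluster_le:
  assumes "(u, v) \<in> super_strong_Wilf" "length u = length v" and E: "E \<subseteq> {e. e + length u \<le> L}"
  shows "sum_list (cluster v E L) \<le> sum_list (cluster u E L)"
proof -
  obtain f where f: "bij_betw f pos_words pos_words"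
    and *: "\<And>w. w \<in> pos_words \<Longrightarrow> length (f w) = length w \<and> sum_list (f w) = sum_list w \<and> Em u w = Em v (f w)"
    using assms(1) unfolding super_strong_Wilf_def by blast
  let ?c = "cluster u E L"
  have c: "?c \<in> pos_words" by (rule cluster_pos_word)
  have fc: "f ?c \<in> pos_words" using f c by (auto simp: bij_betw_def)
  have len: "length (f ?c) = L" using *[OF c] by simp
  have "E \<subseteq> embeddings u ?c" using embeddings_superset_iff[OF E c] by simp
  then have "E \<subseteq> embeddings v (f ?c)" using *[OF c] Em_eq_iff by metis
  then have "\<forall>p<L. cluster v E L ! p \<le> f ?c ! p"
    using embeddings_superset_iff[of E v L "f ?c"] E assms(2) fc len by simp
  then have "sum_list (cluster v E L) \<le> sum_list (f ?c)"
    unfolding sum_list_sum_nth using len by (auto intro: sum_mono)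
  then show ?thesis using *[OF c] by simp
qed

lemma super_strong_Wilf_imp_translates:
  assumes ss: "(u, v) \<in> super_strong_Wilf"
  shows "length u = length v" "translates (level_set u t) (level_set v t)"
proof -
  have ss': "(v, u) \<in> super_strong_Wilf" by (rule super_strong_Wilf_sym[OF ss])
  have uv: "u \<in> pos_words" "v \<in> pos_words" using ss by (auto simp: super_strong_Wilf_def)
  show len: "length u = length v"
    using super_strong_Wilf_length_le[OF ss] super_strong_Wilf_length_le[OF ss'] by simp
  define M where "M = Max (insert 1 (set u \<union> set v))"
  have M: "1 \<le> M" "\<forall>a\<in>set u. a \<le> M" "\<forall>a\<in>set v. a \<le> M" by (auto simp: M_def)
  have eq_nat: "(\<Sum>t\<in>{1..M}. card (sumset (level_set u t) (int ` E)))
      = (\<Sum>t\<in>{1..M}. card (sumset (level_set v t) (int ` E)))" if "finite E" for E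
  proof -
    define L where "L = Max (insert 0 E) + length u"
    have Eu: "E \<subseteq> {e. e + length u \<le> L}" using that by (auto simp: L_def)
    have Ev: "E \<subseteq> {e. e + length v \<le> L}" using Eu by (simp add: len)
    have "sum_list (cluster u E L) = sum_list (cluster v E L)"
      using super_strong_Wilf_cluster_le[OF ss len Eu]
        super_strong_Wilf_cluster_le[OF ss' len[symmetric] Ev] by simp
    then show ?thesis
      using sum_list_cluster[OF uv(1) M(1,2) Eu] sum_list_cluster[OF uv(2) M(1,3) Ev]
      by (simp add: len)
  qed
  have eq: "(\<Sum>t\<in>{1..M}. card (sumset (level_set u t) E))
      = (\<Sum>t\<in>{1..M}. card (sumset (level_set v t) E))" if "finite E" for E
  proof -
    \<comment> \<open>Places in words are natural numbers, so \<open>E\<close> is first shifted to the right.\<close>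
    define c where "c = (\<Sum>x\<in>E. \<bar>x\<bar>)"
    have "0 \<le> c + x" if "x \<in> E" for x
      using member_le_sum[of x E abs] that \<open>finite E\<close> unfolding c_def by fastforce
    then have "int ` nat ` (+) c ` E = (+) c ` E" by (force simp: image_image)
    then have "card (sumset A (int ` nat ` (+) c ` E)) = card (sumset A E)" for A
      by (simp add: card_sumset_shift_right)
    then show ?thesis using eq_nat[of "nat ` (+) c ` E"] that by simp
  qed
  show "translates (level_set u t) (level_set v t)"
  proof (cases "t \<in> {1..M}")
    case True
    show ?thesis
    proof (rule decreasing_families_translates[OF _ _ _ _ eq True])
      show "level_set u t \<subseteq> {0..int (length u)}" "level_set v t \<subseteq> {0..int (length u)}" for t
        using level_set_bounds len by metis+
    qed (auto intro: level_set_antimono[THEN subsetD])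
  next
    case False
    then consider "t \<le> 1" | "M < t" by fastforce
    then show ?thesis
    proof cases
      case 1
      then show ?thesis using uv len translates_refl by (simp add: level_set_pos_word)
    next
      case 2
      then have "level_set u t = {}" "level_set v t = {}"
        using M by (auto intro!: level_set_empty)
      then show ?thesis using translates_refl by simp
    qed
  qed
qed

lemma ex_fiber_preserving_bij:
  assumes fin: "\<And>c. finite {w \<in> P. g w = c}"  "\<And>c. finite {w \<in> P. h w = c}"
    and card: "\<And>c. card {w \<in> P. g w = c} = card {w \<in> P. h w = c}"
  shows "\<exists>f. bij_betw f P P \<and> (\<forall>w\<in>P. h (f w) = g w)"
proof -
  have "\<exists>F. bij_betw F {w \<in> P. g w = c} {w \<in> P. h w = c}" for c
    using finite_same_card_bij[of "{w \<in> P. g w = c}" "{w \<in> P. h w = c}"] fin card by blast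
  then obtain F where F: "\<And>c. bij_betw (F c) {w \<in> P. g w = c} {w \<in> P. h w = c}"
    using choice[of "\<lambda>c F. bij_betw F {w \<in> P. g w = c} {w \<in> P. h w = c}"] by blast
  define f where "f w = F (g w) w" for w
  have f: "f w \<in> P \<and> h (f w) = g w" if "w \<in> P" for w
    using bij_betwE[OF F[of "g w"]] that by (auto simp: f_def)
  have "inj_on f P"
  proof (rule inj_onI)
    fix w w' assume w: "w \<in> P" "w' \<in> P" "f w = f w'"
    then have "g w = g w'" using f[OF w(1)] f[OF w(2)] by simp
    then show "w = w'" using w bij_betw_imp_inj_on[OF F[of "g w"]]
      by (auto simp: f_def inj_on_def)
  qed
  moreover have "P \<subseteq> f ` P"
  proof
    fix y assume "y \<in> P"
    then have "y \<in> F (h y) ` {w \<in> P. g w = h y}" using F[of "h y"] by (simp add: bij_betw_def)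
    then obtain w where w: "w \<in> P" "g w = h y" "y = F (h y) w" by blast
    then have "y = f w" by (simp add: f_def)
    then show "y \<in> f ` P" using w(1) by blast
  qed
  ultimately show ?thesis using f by (auto simp: bij_betw_def)
qed

text \<open>
  Inversion over the supersets of \<open>E\<close>, by induction on the size of the complement of \<open>E\<close>.
\<close>

lemma card_fibers_eq_if_supersets:
  fixes g h :: "'a \<Rightarrow> 'b set"
  assumes W: "finite W" and X: "finite X" and gh: "g ` W \<subseteq> Pow X" "h ` W \<subseteq> Pow X"
    and eq: "\<And>E. E \<subseteq> X \<Longrightarrow> card {w \<in> W. E \<subseteq> g w} = card {w \<in> W. E \<subseteq> h w}"
  shows "card {w \<in> W. g w = E} = card {w \<in> W. h w = E}"
proof (cases "E \<subseteq> X")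
  case False
  have "{w \<in> W. k w = E} = {}" if "k ` W \<subseteq> Pow X" for k using that False by auto
  from this[OF gh(1)] this[OF gh(2)] show ?thesis by (metis (lifting))
next
  case True
  have split: "card {w \<in> W. E \<subseteq> k w}
      = card {w \<in> W. k w = E} + (\<Sum>F\<in>{F. E \<subset> F \<and> F \<subseteq> X}. card {w \<in> W. k w = F})"
    if k: "k ` W \<subseteq> Pow X" and E: "E \<subseteq> X" for k :: "'a \<Rightarrow> 'b set" and E
  proof -
    have "finite {F. E \<subset> F \<and> F \<subseteq> X}" using X by (auto intro: rev_finite_subset[of "Pow X"])
    have "{w \<in> W. E \<subseteq> k w} = (\<Union>F\<in>insert E {F. E \<subset> F \<and> F \<subseteq> X}. {w \<in> W. k w = F})"
    proof (intro set_eqI iffI)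
      fix w assume w: "w \<in> {w \<in> W. E \<subseteq> k w}"
      then have "k w \<in> insert E {F. E \<subset> F \<and> F \<subseteq> X}" using k by blast
      then show "w \<in> (\<Union>F\<in>insert E {F. E \<subset> F \<and> F \<subseteq> X}. {w \<in> W. k w = F})"
        using w by blast
    qed blast
    then have "card {w \<in> W. E \<subseteq> k w}
        = card (\<Union>F\<in>insert E {F. E \<subset> F \<and> F \<subseteq> X}. {w \<in> W. k w = F})"
      by (rule arg_cong)
    also have "\<dots> = (\<Sum>F\<in>insert E {F. E \<subset> F \<and> F \<subseteq> X}. card {w \<in> W. k w = F})"
      using W \<open>finite {F. E \<subset> F \<and> F \<subseteq> X}\<close> by (intro card_UN_disjoint) auto
    finally show ?thesis using \<open>finite {F. E \<subset> F \<and> F \<subseteq> X}\<close> by simp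
  qed
  show ?thesis using True
  proof (induction "card (X - E)" arbitrary: E rule: less_induct)
    case less
    have "card {w \<in> W. g w = F} = card {w \<in> W. h w = F}" if "E \<subset> F" "F \<subseteq> X" for F
    proof (rule less.hyps)
      have "X - F \<subset> X - E" using that by blast
      then show "card (X - F) < card (X - E)" using X by (intro psubset_card_mono) auto
    qed (fact that(2))
    then have "(\<Sum>F\<in>{F. E \<subset> F \<and> F \<subseteq> X}. card {w \<in> W. g w = F})
        = (\<Sum>F\<in>{F. E \<subset> F \<and> F \<subseteq> X}. card {w \<in> W. h w = F})"
      by (intro sum.cong) auto
    then show ?case
      using split[OF gh(1) less.prems] split[OF gh(2) less.prems] eq[OF less.prems] by simp
  qed
qed

lemma finite_pos_words: "finite {w \<in> pos_words. length w = L \<and> sum_list w = h}"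
proof (rule finite_subset)
  show "{w \<in> pos_words. length w = L \<and> sum_list w = h} \<subseteq> {w. set w \<subseteq> {..h} \<and> length w = L}"
    using member_le_sum_list by fastforce
qed (simp add: finite_lists_length_eq)

text \<open>
  Replacing the lower bound \<open>a\<close> by \<open>b\<close>, that is adding \<open>b - a\<close> to a word pointwise, is
  injective and keeps the height.
\<close>

lemma card_words_above_le:
  assumes len: "length a = L" "length b = L" and b: "b \<in> pos_words"
    and sum: "sum_list a = sum_list b"
  shows "card {w \<in> pos_words. length w = L \<and> sum_list w = h \<and> (\<forall>p<L. a ! p \<le> w ! p)}
    \<le> card {w \<in> pos_words. length w = L \<and> sum_list w = h \<and> (\<forall>p<L. b ! p \<le> w ! p)}"
    (is "card ?A \<le> card ?B")
proof (rule card_inj_on_le)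
  let ?f = "\<lambda>w. map (\<lambda>p. w ! p - a ! p + b ! p) [0..<L]"
  show "inj_on ?f ?A"
  proof (rule inj_onI)
    fix w w' assume w: "w \<in> ?A" "w' \<in> ?A" and eq: "?f w = ?f w'"
    show "w = w'"
    proof (rule nth_equalityI)
      fix p assume "p < length w"
      then have p: "p < L" using w(1) by simp
      then have "?f w ! p = ?f w' ! p" using eq by simp
      then have "w ! p - a ! p = w' ! p - a ! p" using p by simp
      moreover have "a ! p \<le> w ! p" "a ! p \<le> w' ! p" using w p by simp_all
      ultimately show "w ! p = w' ! p" by simp
    qed (use w in simp)
  qed
  show "?f ` ?A \<subseteq> ?B"
  proof
    fix x assume "x \<in> ?f ` ?A"
    then obtain w where w: "w \<in> ?A" and x: "x = ?f w" by blast
    have "1 \<le> b ! p" if "p < L" for p using b that len by (auto simp: pos_words_def)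
    then have "x \<in> pos_words" unfolding x pos_words_def by (fastforce intro: trans_le_add2)
    moreover have "sum_list x = h"
    proof -
      have "sum_list x = (\<Sum>p<L. w ! p - a ! p + b ! p)"
        unfolding x by (simp add: interv_sum_list_conv_sum_set_nat atLeast0LessThan)
      also have "\<dots> = (\<Sum>p<L. w ! p) - (\<Sum>p<L. a ! p) + (\<Sum>p<L. b ! p)"
        unfolding sum.distrib using w by (subst sum_subtractf_nat) auto
      also have "(\<Sum>p<L. a ! p) = (\<Sum>p<L. b ! p)"
        using sum len by (simp add: sum_list_sum_nth atLeast0LessThan)
      also have "(\<Sum>p<L. w ! p) - (\<Sum>p<L. b ! p) + (\<Sum>p<L. b ! p) = (\<Sum>p<L. w ! p)"
      proof -
        have "(\<Sum>p<L. a ! p) \<le> (\<Sum>p<L. w ! p)" using w by (intro sum_mono) auto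
        then show ?thesis using \<open>(\<Sum>p<L. a ! p) = (\<Sum>p<L. b ! p)\<close> by simp
      qed
      also have "\<dots> = h" using w by (auto simp: sum_list_sum_nth atLeast0LessThan)
      finally show ?thesis .
    qed
    ultimately show "x \<in> ?B" by (simp add: x)
  qed
  show "finite ?B" by (rule finite_subset[OF _ finite_pos_words[of L h]]) auto
qed

text \<open>
  Words are sorted by length, height and set of embedding places. The numbers of words whose
  embedding places contain \<open>E\<close> agree for \<open>u\<close> and \<open>v\<close>, because they only depend on the height of
  the cluster; so the numbers with embedding places exactly \<open>E\<close> agree, and a bijection can be
  chosen class by class.
\<close>

lemma translates_imp_super_strong_Wilf:
  assumes uv: "u \<in> pos_words" "v \<in> pos_words" and len: "length u = length v"
    and tr: "\<And>t. translates (level_set u t) (level_set v t)"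
  shows "(u, v) \<in> super_strong_Wilf"
proof -
  define M where "M = Max (insert 1 (set u \<union> set v))"
  have M: "1 \<le> M" "\<forall>a\<in>set u. a \<le> M" "\<forall>a\<in>set v. a \<le> M" by (auto simp: M_def)
  have cluster_eq: "sum_list (cluster u E L) = sum_list (cluster v E L)"
    if E: "E \<subseteq> {e. e + length u \<le> L}" for E L
  proof -
    have "(\<Sum>t\<in>{1..M}. card (sumset (level_set u t) (int ` E)))
        = (\<Sum>t\<in>{1..M}. card (sumset (level_set v t) (int ` E)))"
      by (intro sum.cong refl card_sumset_translates tr)
    then show ?thesis
      using sum_list_cluster[OF uv(1) M(1,2) E] sum_list_cluster[OF uv(2) M(1,3), of E L] E len
      by simp
  qed
  have super: "card {w \<in> {w \<in> pos_words. length w = L \<and> sum_list w = h}. E \<subseteq> embeddings u w}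
      = card {w \<in> {w \<in> pos_words. length w = L \<and> sum_list w = h}. E \<subseteq> embeddings v w}"
    if E: "E \<subseteq> {e. e + length u \<le> L}" for E L h
  proof -
    have above: "{w \<in> {w \<in> pos_words. length w = L \<and> sum_list w = h}. E \<subseteq> embeddings x w}
        = {w \<in> pos_words. length w = L \<and> sum_list w = h \<and> (\<forall>p<L. cluster x E L ! p \<le> w ! p)}"
      if "length x = length u" for x
    proof -
      have "E \<subseteq> {e. e + length x \<le> L}" using E that by simp
      then show ?thesis using embeddings_superset_iff[of E x L] by blast
    qed
    show ?thesis
      unfolding above[OF refl] above[OF len[symmetric]]
      by (intro antisym card_words_above_le) (simp_all add: cluster_eq[OF E] cluster_pos_word)
  qed
  have fibers: "card {w \<in> {w \<in> pos_words. length w = L \<and> sum_list w = h}. embeddings u w = E}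
      = card {w \<in> {w \<in> pos_words. length w = L \<and> sum_list w = h}. embeddings v w = E}" for E L h
  proof (rule card_fibers_eq_if_supersets[where X = "{e. e + length u \<le> L}", OF finite_pos_words _ _ _ super])
    show "finite {e. e + length u \<le> L}" by (rule finite_subset[of _ "{..L}"]) auto
    have "embeddings x ` {w \<in> pos_words. length w = L \<and> sum_list w = h} \<subseteq> Pow {e. e + length u \<le> L}"
      if "length x = length u" for x
      using embeddings_bound[of x] that by auto
    from this[OF refl] this[OF len[symmetric]]
    show "embeddings u ` {w \<in> pos_words. length w = L \<and> sum_list w = h} \<subseteq> Pow {e. e + length u \<le> L}"
      "embeddings v ` {w \<in> pos_words. length w = L \<and> sum_list w = h} \<subseteq> Pow {e. e + length u \<le> L}" .
  qed
  define key where "key = (\<lambda>x w. (length w, sum_list w, embeddings x w))"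
  have key_fiber: "{w \<in> pos_words. key x w = (L, h, E)}
      = {w \<in> {w \<in> pos_words. length w = L \<and> sum_list w = h}. embeddings x w = E}" for x L h E
    by (auto simp: key_def)
  have "finite {w \<in> pos_words. key x w = (L, h, E)}" for x L h E
    unfolding key_fiber by (rule finite_subset[OF _ finite_pos_words[of L h]]) blast
  then have fin: "finite {w \<in> pos_words. key x w = c}" for x c
    by (metis prod_cases3)
  have "card {w \<in> pos_words. key u w = (L, h, E)} = card {w \<in> pos_words. key v w = (L, h, E)}" for L h E
    unfolding key_fiber by (rule fibers)
  then have "card {w \<in> pos_words. key u w = c} = card {w \<in> pos_words. key v w = c}" for c
    by (cases c) blast
  then obtain f where "bij_betw f pos_words pos_words" "\<forall>w\<in>pos_words. key v (f w) = key u w"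
    using ex_fiber_preserving_bij[of pos_words "key u" "key v", OF fin fin] by blast
  then show ?thesis
    unfolding super_strong_Wilf_def Em_eq_iff key_def using uv by auto
qed

theorem super_strong_Wilf_iff:
  assumes "u \<in> pos_words" "v \<in> pos_words"
  shows "(u, v) \<in> super_strong_Wilf \<longleftrightarrow>
    length u = length v \<and> (\<forall>t. translates (level_set u t) (level_set v t))"
  using assms super_strong_Wilf_imp_translates translates_imp_super_strong_Wilf by blast

lemma equiv_super_strong_Wilf: "equiv pos_words super_strong_Wilf"
proof (rule equivI)
  show sub: "super_strong_Wilf \<subseteq> pos_words \<times> pos_words" by (auto simp: super_strong_Wilf_def)
  show "refl_on pos_words super_strong_Wilf"
    by (rule refl_onI) (simp add: super_strong_Wilf_iff translates_refl)
  show "sym super_strong_Wilf" by (rule symI) (rule super_strong_Wilf_sym)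
  show "trans super_strong_Wilf"
  proof (rule transI)
    fix x y z assume xyz: "(x, y) \<in> super_strong_Wilf" "(y, z) \<in> super_strong_Wilf"
    then have mem: "x \<in> pos_words" "y \<in> pos_words" "z \<in> pos_words" using sub by auto
    show "(x, z) \<in> super_strong_Wilf"
      unfolding super_strong_Wilf_iff[OF mem(1,3)]
    proof (intro conjI allI)
      show "length x = length z"
        using super_strong_Wilf_imp_translates(1)[OF xyz(1)] super_strong_Wilf_imp_translates(1)[OF xyz(2)] by simp
      show "translates (level_set x t) (level_set z t)" for t
        using super_strong_Wilf_imp_translates(2)[OF xyz(1)] super_strong_Wilf_imp_translates(2)[OF xyz(2)]
        by (rule translates_trans)
    qed
  qed
qed

section \<open>Vertices and levels of the tree\<close>

lemma Some_in_image [simp]: "Some a \<in> Some ` A \<longleftrightarrow> a \<in> A"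
  by auto

text \<open>
  The star set of the ancestor at level \<open>i\<close> of a vertex \<open>x\<close>: letters greater than \<open>i\<close> count as
  stars, so that ancestors need not be formed.
\<close>

definition above :: "nat \<Rightarrow> nat option list \<Rightarrow> int set" where
  "above i x = int ` {k. k < length x \<and> x ! k \<notin> Some ` {1..i}}"

lemma int_in_above: "int p \<in> above i x \<longleftrightarrow> p < length x \<and> x ! p \<notin> Some ` {1..i}"
  by (auto simp: above_def)

lemma finite_above: "finite (above i x)"
  by (simp add: above_def)

lemma above_zero: "above 0 x = int ` {..<length x}"
  by (auto simp: above_def)

lemma count_list_eq_1_iff: "count_list x a = 1 \<longleftrightarrow> (\<exists>!k. k < length x \<and> x ! k = a)"
proof -
  have "count_list x a = card {k. k < length x \<and> x ! k = a}"
    by (simp add: count_list_eq_length_filter length_filter_conv_card eq_commute)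
  then show ?thesis
    by (simp add: card_1_singleton_iff Ex1_def set_eq_iff) metis
qed

text \<open>
  The prescribed multiplicities already add up to \<open>n\<close>, so letters greater than \<open>i\<close> do not
  occur.
\<close>

lemma star_words_iff:
  "x \<in> star_words n i \<longleftrightarrow> i \<le> n \<and> length x = n \<and> set x \<subseteq> insert None (Some ` {1..i}) \<and>
    (\<forall>j\<in>{1..i}. \<exists>!k. k < n \<and> x ! k = Some j)"
proof
  assume x: "x \<in> star_words n i"
  then have len: "length x = n" and sub: "set x \<subseteq> insert None (Some ` {1..n})"
    and one: "\<And>j. j \<in> {1..i} \<Longrightarrow> count_list x (Some j) = 1" and none: "count_list x None = n - i"
    by (auto simp: star_words_def)
  have i: "i \<le> n"
  proof (rule ccontr)
    assume "\<not> i \<le> n"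
    then have "Some i \<notin> set x" "count_list x (Some i) = 1" using sub one[of i] by auto
    then show False by (simp add: count_list_0_iff[THEN iffD2])
  qed
  have "n = (\<Sum>a\<in>insert None (Some ` {1..n}). count_list x a)"
    using sum_count_set[OF sub] len by simp
  also have "\<dots> = (n - i) + (\<Sum>j\<in>{1..n}. count_list x (Some j))"
    by (simp add: none sum.reindex)
  also have "{1..n} = {1..i} \<union> {i<..n}" using i by auto
  also have "(\<Sum>j\<in>{1..i} \<union> {i<..n}. count_list x (Some j)) = i + (\<Sum>j\<in>{i<..n}. count_list x (Some j))"
    using one by (subst sum.union_disjoint) auto
  finally have "(\<Sum>j\<in>{i<..n}. count_list x (Some j)) = 0" using i by simp
  then have "Some j \<notin> set x" if "j \<in> {i<..n}" for j using that by (simp add: count_list_0_iff)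
  then have "set x \<subseteq> insert None (Some ` {1..i})" using sub by (auto simp: not_less)
  then show "i \<le> n \<and> length x = n \<and> set x \<subseteq> insert None (Some ` {1..i}) \<and>
    (\<forall>j\<in>{1..i}. \<exists>!k. k < n \<and> x ! k = Some j)"
    using i len one unfolding count_list_eq_1_iff by simp
next
  assume r: "i \<le> n \<and> length x = n \<and> set x \<subseteq> insert None (Some ` {1..i}) \<and>
    (\<forall>j\<in>{1..i}. \<exists>!k. k < n \<and> x ! k = Some j)"
  then have one: "count_list x (Some j) = 1" if "j \<in> {1..i}" for j
    using that unfolding count_list_eq_1_iff by simp
  have "n = (\<Sum>a\<in>insert None (Some ` {1..i}). count_list x a)"
    using sum_count_set[of x "insert None (Some ` {1..i})"] r by simp
  also have "\<dots> = count_list x None + i" using one by (simp add: sum.reindex)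
  finally have "count_list x None = n - i" by simp
  moreover have "set x \<subseteq> insert None (Some ` {1..n})"
  proof -
    have "Some ` {1..i} \<subseteq> Some ` {1..n}" using r by (intro image_mono) auto
    then show ?thesis using r by blast
  qed
  ultimately show "x \<in> star_words n i" using r one unfolding star_words_def by blast
qed

lemma star_words_length: "x \<in> star_words n i \<Longrightarrow> length x = n"
  by (simp add: star_words_def)

lemma star_words_nth: "x \<in> star_words n i \<Longrightarrow> k < n \<Longrightarrow> x ! k = None \<or> (\<exists>j\<in>{1..i}. x ! k = Some j)"
  using nth_mem[of k x] unfolding star_words_iff by blast

lemma star_words_unique: "x \<in> star_words n i \<Longrightarrow> j \<in> {1..i} \<Longrightarrow> \<exists>!k. k < n \<and> x ! k = Some j"
  unfolding star_words_iff by blast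

lemma star_plus_mset_eq_dists:
  assumes x: "x \<in> star_words n i" and j: "j \<in> {1..i}" and p: "p < n" "x ! p = Some j"
  shows "star_plus_mset i x j = dists (int p) (above j x)"
proof -
  have len: "length x = n" and sub: "set x \<subseteq> insert None (Some ` {1..i})"
    and uniq: "\<exists>!k. k < n \<and> x ! k = Some j"
    using x j by (auto simp: star_words_iff)
  let ?L = "{l. l < n \<and> x ! l \<notin> Some ` {1..j}}"
  have mem: "x ! l \<in> insert None (Some ` {j+1..i}) \<longleftrightarrow> x ! l \<notin> Some ` {1..j}" if "l < n" for l
  proof -
    have "x ! l \<in> insert None (Some ` {1..i})" using that sub len nth_mem by blast
    then show ?thesis by auto
  qed
  have at_p: "x ! k = Some j \<longleftrightarrow> k = p" if "k < n" for k using uniq that p by blast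
  have "{(k, l). k < n \<and> l < n \<and> P k \<and> M l} = Pair p ` {l. l < n \<and> N l}"
    if "\<And>k. k < n \<Longrightarrow> P k \<longleftrightarrow> k = p" "\<And>l. l < n \<Longrightarrow> M l \<longleftrightarrow> N l" for P M N
    using that p(1) by auto
  from this[OF at_p mem] have "{(k, l). k < length x \<and> l < length x \<and> x ! k = Some j \<and> x ! l \<in> insert None (Some ` {j+1..i})}
      = Pair p ` ?L"
    by (simp only: len)
  then have "star_plus_mset i x j = image_mset (\<lambda>(k, l). absdiff k l) (mset_set (Pair p ` ?L))"
    by (simp only: star_plus_mset_def)
  also have "mset_set (Pair p ` ?L) = image_mset (Pair p) (mset_set ?L)"
    by (simp add: image_mset_mset_set inj_on_def)
  also have "image_mset (\<lambda>(k, l). absdiff k l) \<dots> = image_mset (\<lambda>l. absdiff p l) (mset_set ?L)"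
    by (simp add: multiset.map_comp o_def)
  also have "\<dots> = image_mset (\<lambda>q. nat \<bar>int p - q\<bar>) (image_mset int (mset_set ?L))"
    by (simp add: multiset.map_comp o_def absdiff_def)
  also have "image_mset int (mset_set ?L) = mset_set (int ` ?L)"
    by (simp add: image_mset_mset_set)
  finally show ?thesis by (simp add: dists_def above_def len)
qed

lemma tree_level_iff:
  "x \<in> tree_level n u i \<longleftrightarrow> x \<in> star_words n i \<and>
    (\<forall>j\<in>{1..i}. \<forall>p<n. x ! p = Some j \<longrightarrow> dists (int p) (above j x) = plus_mset u j)"
proof (cases "x \<in> star_words n i")
  case True
  have "star_plus_mset i x j = plus_mset u j \<longleftrightarrow>
      (\<forall>p<n. x ! p = Some j \<longrightarrow> dists (int p) (above j x) = plus_mset u j)" if j: "j \<in> {1..i}" for j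
  proof -
    have "\<exists>!k. k < n \<and> x ! k = Some j" by (rule star_words_unique[OF True j])
    then obtain p where p: "p < n" "x ! p = Some j" "\<And>k. k < n \<Longrightarrow> x ! k = Some j \<Longrightarrow> k = p" by blast
    then have "(\<forall>p<n. x ! p = Some j \<longrightarrow> R p) \<longleftrightarrow> R p" for R by blast
    then show ?thesis by (simp only: star_plus_mset_eq_dists[OF True j p(1,2)])
  qed
  then show ?thesis using True by (simp add: tree_level_def)
qed (simp add: tree_level_def)

lemma tree_level_dists:
  "x \<in> tree_level n u i \<Longrightarrow> j \<in> {1..i} \<Longrightarrow> p < n \<Longrightarrow> x ! p = Some j
    \<Longrightarrow> dists (int p) (above j x) = plus_mset u j"
  unfolding tree_level_iff by blast

lemma above_Suc_eq:
  assumes "x \<in> star_words n i" "j < i" "p < n" "x ! p = Some (Suc j)"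
  shows "above (Suc j) x = above j x - {int p}" "int p \<in> above j x"
proof -
  have "\<exists>!k. k < n \<and> x ! k = Some (Suc j)" using star_words_unique[OF assms(1), of "Suc j"] assms(2) by simp
  then have uniq: "x ! k = Some (Suc j) \<longleftrightarrow> k = p" if "k < n" for k using that assms(3,4) by blast
  have len: "length x = n" using assms(1) by (rule star_words_length)
  have "Some ` {1..Suc j} = insert (Some (Suc j)) (Some ` {1..j})"
    by (auto simp: atLeastAtMostSuc_conv)
  then have "{k. k < length x \<and> x ! k \<notin> Some ` {1..Suc j}}
      = {k. k < length x \<and> x ! k \<notin> Some ` {1..j}} - {p}"
    using uniq len by auto
  then show "above (Suc j) x = above j x - {int p}"
    by (simp add: above_def image_set_diff)
  show "int p \<in> above j x" using assms len by (auto simp: int_in_above)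
qed

lemma tree_level_step:
  assumes x: "x \<in> tree_level n u i" and j: "j < i"
  obtains q where "q \<in> removable (plus_mset u (Suc j)) (above j x)" "above (Suc j) x = above j x - {q}"
proof -
  have w: "x \<in> star_words n i" using x by (simp add: tree_level_def)
  have "\<exists>!k. k < n \<and> x ! k = Some (Suc j)" using star_words_unique[OF w, of "Suc j"] j by simp
  then obtain p where p: "p < n" "x ! p = Some (Suc j)" by blast
  note step = above_Suc_eq[OF w j p]
  have "dists (int p) (above (Suc j) x) = plus_mset u (Suc j)"
    using x j p unfolding tree_level_iff by force
  then have "int p \<in> removable (plus_mset u (Suc j)) (above j x)"
    using step by (simp add: removable_def)
  then show thesis using that step(1) by blast
qed

lemma above_update_le: "j \<le> i \<Longrightarrow> x ! p = None \<Longrightarrow> above j (x[p := Some (Suc i)]) = above j x"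
proof -
  assume j: "j \<le> i" and p: "x ! p = None"
  have "x[p := Some (Suc i)] ! k \<notin> Some ` {1..j} \<longleftrightarrow> x ! k \<notin> Some ` {1..j}" if "k < length x" for k
    using j p that by (cases "k = p") auto
  then show ?thesis unfolding above_def by (intro arg_cong[of _ _ "image int"]) auto
qed

lemma star_words_none_iff:
  assumes "x \<in> star_words n i" "p < n"
  shows "x ! p = None \<longleftrightarrow> int p \<in> above i x"
proof -
  show ?thesis
    using star_words_nth[OF assms] star_words_length[OF assms(1)] assms(2)
    by (auto simp: int_in_above)
qed

lemma star_words_update:
  assumes x: "x \<in> star_words n i" and p: "p < n" "x ! p = None"
  shows "x[p := Some (Suc i)] \<in> star_words n (Suc i)"
proof -
  have len: "length x = n" and sub: "set x \<subseteq> insert None (Some ` {1..i})" and i: "i \<le> n"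
    using x unfolding star_words_iff by blast+
  note uniq = star_words_unique[OF x]
  have "count_list x None \<noteq> 0" using p len by (metis count_list_0_iff nth_mem)
  then have "Suc i \<le> n" using x by (auto simp: star_words_def)
  moreover have "set (x[p := Some (Suc i)]) \<subseteq> insert None (Some ` {1..Suc i})"
  proof -
    have "set (x[p := Some (Suc i)]) \<subseteq> insert (Some (Suc i)) (set x)" by (rule set_update_subset_insert)
    also have "\<dots> \<subseteq> insert None (Some ` {1..Suc i})" using sub by (auto simp: atLeastAtMostSuc_conv)
    finally show ?thesis .
  qed
  moreover have "\<exists>!k. k < n \<and> x[p := Some (Suc i)] ! k = Some j" if j: "j \<in> {1..Suc i}" for j
  proof (cases "j = Suc i")
    case True
    have "x ! k \<noteq> Some (Suc i)" if "k < n" for k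
      using star_words_nth[OF x that] by auto
    then have "k < n \<and> x[p := Some (Suc i)] ! k = Some j \<longleftrightarrow> k = p" for k
      using True p len by (cases "k = p") auto
    then show ?thesis by simp
  next
    case False
    then have "k < n \<and> x[p := Some (Suc i)] ! k = Some j \<longleftrightarrow> k < n \<and> x ! k = Some j" for k
      using p len by (cases "k = p") auto
    then show ?thesis using uniq[of j] j False by simp
  qed
  ultimately show ?thesis using len by (simp add: star_words_iff)
qed

lemma star_words_erase:
  assumes y: "y \<in> star_words n (Suc i)" and p: "p < n" "y ! p = Some (Suc i)"
  shows "y[p := None] \<in> star_words n i"
proof -
  have len: "length y = n" and i: "Suc i \<le> n"
    using y unfolding star_words_iff by blast+
  note uniq = star_words_unique[OF y]
  have p_uniq: "k = p" if "k < n" "y ! k = Some (Suc i)" for k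
    using uniq[of "Suc i"] that p by (metis atLeastAtMost_iff le_add1 order_refl plus_1_eq_Suc)
  have "y[p := None] ! k \<in> insert None (Some ` {1..i})" if k: "k < n" for k
  proof (cases "k = p")
    case False
    then show ?thesis using star_words_nth[OF y k] p_uniq[OF k] by (auto simp: le_Suc_eq)
  qed (use len k in simp)
  then have "set (y[p := None]) \<subseteq> insert None (Some ` {1..i})"
    using len by (intro subsetI) (metis in_set_conv_nth length_list_update)
  moreover have "\<exists>!k. k < n \<and> y[p := None] ! k = Some j" if j: "j \<in> {1..i}" for j
  proof -
    have "k < n \<and> y[p := None] ! k = Some j \<longleftrightarrow> k < n \<and> y ! k = Some j" for k
      using p len j by (cases "k = p") auto
    then show ?thesis using uniq[of j] j by simp
  qed
  ultimately show ?thesis using len i by (simp add: star_words_iff)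
qed

lemma tree_level_update:
  assumes x: "x \<in> tree_level n u i" and p: "int p \<in> removable (plus_mset u (Suc i)) (above i x)"
  shows "x[p := Some (Suc i)] \<in> tree_level n u (Suc i)"
    "\<And>j. j \<le> i \<Longrightarrow> above j (x[p := Some (Suc i)]) = above j x"
    "above (Suc i) (x[p := Some (Suc i)]) = above i x - {int p}"
    "p < n" "x ! p = None"
proof -
  let ?y = "x[p := Some (Suc i)]"
  have w: "x \<in> star_words n i" using x by (simp add: tree_level_def)
  have len: "length x = n" using w by (rule star_words_length)
  have pa: "int p \<in> above i x" using p by (simp add: removable_def)
  show pn: "p < n" using pa len by (simp add: int_in_above)
  show none: "x ! p = None" using star_words_none_iff[OF w pn] pa by simp
  have wy: "?y \<in> star_words n (Suc i)" by (rule star_words_update[OF w pn none])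
  show le: "above j ?y = above j x" if "j \<le> i" for j by (rule above_update_le[OF that none])
  have yp: "?y ! p = Some (Suc i)" using pn len by simp
  show Suc: "above (Suc i) ?y = above i x - {int p}"
    using above_Suc_eq(1)[OF wy _ pn yp] le[of i] by simp
  have "dists (int q) (above j ?y) = plus_mset u j"
    if j: "j \<in> {1..Suc i}" and q: "q < n" "?y ! q = Some j" for j q
  proof (cases "j = Suc i")
    case True
    have "\<exists>!k. k < n \<and> ?y ! k = Some (Suc i)" using star_words_unique[OF wy, of "Suc i"] by simp
    then have "q = p" using q yp pn True by blast
    then show ?thesis using True Suc p by (simp add: removable_def)
  next
    case False
    then have "q \<noteq> p" using yp q by auto
    then have "x ! q = Some j" "j \<in> {1..i}" using q j False by auto
    then show ?thesis using x q(1) le[of j] by (simp add: tree_level_iff)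
  qed
  then show "?y \<in> tree_level n u (Suc i)" using wy unfolding tree_level_iff by blast
qed

lemma tree_level_parent:
  assumes y: "y \<in> tree_level n u (Suc i)"
  obtains x p where "x \<in> tree_level n u i" "int p \<in> removable (plus_mset u (Suc i)) (above i x)"
    "y = x[p := Some (Suc i)]"
proof -
  have w: "y \<in> star_words n (Suc i)" using y by (simp add: tree_level_def)
  have len: "length y = n" using w by (rule star_words_length)
  have "\<exists>!k. k < n \<and> y ! k = Some (Suc i)" using star_words_unique[OF w, of "Suc i"] by simp
  then obtain p where p: "p < n" "y ! p = Some (Suc i)" by blast
  define x where "x = y[p := None]"
  have wx: "x \<in> star_words n i" unfolding x_def by (rule star_words_erase[OF w p])
  have y_eq: "y = x[p := Some (Suc i)]" using p by (simp add: x_def) (metis list_update_id)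
  have none: "x ! p = None" using p len by (simp add: x_def)
  have le: "above j y = above j x" if "j \<le> i" for j
    unfolding y_eq by (rule above_update_le[OF that none])
  have "dists (int q) (above j x) = plus_mset u j" if j: "j \<in> {1..i}" and q: "q < n" "x ! q = Some j" for j q
  proof -
    have "q \<noteq> p" using q none by auto
    then have "y ! q = Some j" using q by (simp add: x_def)
    then show ?thesis using tree_level_dists[OF y _ q(1), of j] j le[of j] by simp
  qed
  then have x: "x \<in> tree_level n u i" using wx unfolding tree_level_iff by blast
  have "dists (int p) (above (Suc i) y) = plus_mset u (Suc i)"
    using y p unfolding tree_level_iff by force
  then have "int p \<in> removable (plus_mset u (Suc i)) (above i x)"
    using above_Suc_eq[OF w _ p] le[of i] by (simp add: removable_def)
  then show thesis using that x y_eq by blast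
qed

lemma children_eq:
  assumes x: "x \<in> tree_level n u i"
  shows "children n u i x
    = (\<lambda>p. x[p := Some (Suc i)]) ` {p. int p \<in> removable (plus_mset u (Suc i)) (above i x)}"
proof (intro set_eqI iffI)
  fix y assume "y \<in> children n u i x"
  then have y: "y \<in> tree_level n u (Suc i)"
    and same: "\<And>j k. j \<in> {1..i} \<Longrightarrow> k < n \<Longrightarrow> x ! k = Some j \<longleftrightarrow> y ! k = Some j"
    by (auto simp: children_def)
  obtain z p where z: "z \<in> tree_level n u i" "int p \<in> removable (plus_mset u (Suc i)) (above i z)"
    "y = z[p := Some (Suc i)]"
    by (rule tree_level_parent[OF y])
  have wx: "x \<in> star_words n i" and wz: "z \<in> star_words n i" using x z(1) by (auto simp: tree_level_def)
  have len: "length x = n" "length z = n" using wx wz by (auto dest: star_words_length)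
  note upd = tree_level_update[OF z(1,2)]
  have "x = z"
  proof (rule nth_equalityI)
    fix k assume "k < length x"
    then have k: "k < n" using len by simp
    have "x ! k = Some j \<longleftrightarrow> z ! k = Some j" if "j \<in> {1..i}" for j
      using same[OF that k] upd(4,5) that len by (cases "k = p") (auto simp: z(3))
    then show "x ! k = z ! k" using star_words_nth[OF wx k] star_words_nth[OF wz k] by metis
  qed (use len in simp)
  then show "y \<in> (\<lambda>p. x[p := Some (Suc i)]) ` {p. int p \<in> removable (plus_mset u (Suc i)) (above i x)}"
    using z by blast
next
  fix y assume "y \<in> (\<lambda>p. x[p := Some (Suc i)]) ` {p. int p \<in> removable (plus_mset u (Suc i)) (above i x)}"
  then obtain p where p: "int p \<in> removable (plus_mset u (Suc i)) (above i x)" and y: "y = x[p := Some (Suc i)]"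
    by blast
  note upd = tree_level_update[OF x p]
  have len: "length x = n" using x by (auto simp: tree_level_def dest: star_words_length)
  have "x ! k = Some j \<longleftrightarrow> y ! k = Some j" if "j \<in> {1..i}" "k < n" for j k
    using upd(4,5) that len by (cases "k = p") (auto simp: y)
  then show "y \<in> children n u i x" using upd(1) by (simp add: children_def y)
qed

text \<open>
  Vertices all of whose ancestors, themselves included, have star sets satisfying \<open>Q\<close>. The
  trivial \<open>Q\<close> gives the whole level; requiring translates of the star sets of a fixed leaf
  gives the part of the level that leads to its super-strong Wilf class.
\<close>

definition filtered_level :: "(nat \<Rightarrow> int set \<Rightarrow> bool) \<Rightarrow> nat \<Rightarrow> nat list \<Rightarrow> nat \<Rightarrow> nat option list set" where
  "filtered_level Q n u i = {x \<in> tree_level n u i. \<forall>j\<le>i. Q j (above j x)}"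

lemma finite_tree_level: "finite (tree_level n u i)"
proof (rule finite_subset)
  show "tree_level n u i \<subseteq> {x. set x \<subseteq> insert None (Some ` {1..n}) \<and> length x = n}"
    by (auto simp: tree_level_def star_words_def)
qed (rule finite_lists_length_eq, simp)

text \<open>
  Writing the letter \<open>i + 1\<close> at a removable position is a bijection from pairs of a vertex and
  such a position onto the next level.
\<close>

lemma card_filtered_level_Suc:
  "card (filtered_level Q n u (Suc i)) = (\<Sum>x\<in>filtered_level Q n u i.
     card {q \<in> removable (plus_mset u (Suc i)) (above i x). Q (Suc i) (above i x - {q})})"
proof -
  define R where "R x = {p. int p \<in> removable (plus_mset u (Suc i)) (above i x) \<and>
    Q (Suc i) (above i x - {int p})}" for x
  have R_card: "card (R x) = card {q \<in> removable (plus_mset u (Suc i)) (above i x). Q (Suc i) (above i x - {q})}" for x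
  proof -
    have "removable (plus_mset u (Suc i)) (above i x) \<subseteq> range int"
      by (auto simp: removable_def above_def)
    then have "int ` R x = {q \<in> removable (plus_mset u (Suc i)) (above i x). Q (Suc i) (above i x - {q})}"
      unfolding R_def by blast
    then show ?thesis by (metis card_image inj_on_of_nat)
  qed
  have R_fin: "finite (R x)" for x
    by (rule finite_subset[of _ "{..<length x}"]) (auto simp: R_def removable_def int_in_above)
  let ?f = "\<lambda>(x, p). x[p := Some (Suc i)]"
  have inj: "inj_on ?f (SIGMA x:filtered_level Q n u i. R x)"
  proof (rule inj_onI, clarify)
    fix x p z q assume x: "x \<in> filtered_level Q n u i" "p \<in> R x" and z: "z \<in> filtered_level Q n u i" "q \<in> R z"
      and eq: "x[p := Some (Suc i)] = z[q := Some (Suc i)]"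
    have xt: "x \<in> tree_level n u i" "int p \<in> removable (plus_mset u (Suc i)) (above i x)"
      and zt: "z \<in> tree_level n u i" "int q \<in> removable (plus_mset u (Suc i)) (above i z)"
      using x z by (auto simp: filtered_level_def R_def)
    note ux = tree_level_update[OF xt] and uz = tree_level_update[OF zt]
    have len: "length x = n" "length z = n" using xt(1) zt(1) by (auto simp: tree_level_def dest: star_words_length)
    have "x[p := Some (Suc i)] \<in> star_words n (Suc i)" using ux(1) by (simp add: tree_level_def)
    then have "\<exists>!k. k < n \<and> x[p := Some (Suc i)] ! k = Some (Suc i)"
      by (rule star_words_unique) simp
    moreover have "x[p := Some (Suc i)] ! p = Some (Suc i)" using ux(4) len by simp
    moreover have "x[p := Some (Suc i)] ! q = Some (Suc i)" unfolding eq using uz(4) len by simp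
    ultimately have pq: "p = q" using ux(4) uz(4) by blast
    have "x = (x[p := Some (Suc i)])[p := None]" using ux(5) by simp (metis list_update_id)
    also have "\<dots> = (z[p := Some (Suc i)])[p := None]" using eq pq by simp
    also have "\<dots> = z" using uz(5) pq by simp (metis list_update_id)
    finally show "x = z \<and> p = q" using pq by simp
  qed
  have "?f ` (SIGMA x:filtered_level Q n u i. R x) = filtered_level Q n u (Suc i)"
  proof (intro set_eqI iffI)
    fix y assume "y \<in> ?f ` (SIGMA x:filtered_level Q n u i. R x)"
    then obtain x p where x: "x \<in> filtered_level Q n u i" "p \<in> R x" and y: "y = x[p := Some (Suc i)]" by auto
    have xt: "x \<in> tree_level n u i" "int p \<in> removable (plus_mset u (Suc i)) (above i x)"
      using x by (auto simp: filtered_level_def R_def)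
    note upd = tree_level_update[OF xt]
    have "Q j (above j y)" if "j \<le> Suc i" for j
    proof (cases "j = Suc i")
      case True
      then show ?thesis using upd(3) x(2) by (simp add: y R_def)
    next
      case False
      then have "j \<le> i" using that by simp
      then show ?thesis using upd(2) x(1) by (simp add: y filtered_level_def)
    qed
    then show "y \<in> filtered_level Q n u (Suc i)" using upd(1) by (simp add: filtered_level_def y)
  next
    fix y assume y: "y \<in> filtered_level Q n u (Suc i)"
    then have "y \<in> tree_level n u (Suc i)" by (simp add: filtered_level_def)
    then obtain x p where x: "x \<in> tree_level n u i" "int p \<in> removable (plus_mset u (Suc i)) (above i x)"
      "y = x[p := Some (Suc i)]" by (rule tree_level_parent)
    note upd = tree_level_update[OF x(1,2)]
    have Q: "Q j (above j y)" if "j \<le> Suc i" for j using y that by (simp add: filtered_level_def)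
    have "Q j (above j x)" if "j \<le> i" for j using Q[of j] that upd(2)[OF that] x(3) by simp
    moreover have "Q (Suc i) (above i x - {int p})" using Q[of "Suc i"] upd(3) x(3) by simp
    ultimately have "x \<in> filtered_level Q n u i" "p \<in> R x"
      using x by (auto simp: filtered_level_def R_def)
    then show "y \<in> ?f ` (SIGMA x:filtered_level Q n u i. R x)" using x(3) by force
  qed
  then have "card (filtered_level Q n u (Suc i)) = card (SIGMA x:filtered_level Q n u i. R x)"
    using card_image[OF inj] by simp
  also have "\<dots> = (\<Sum>x\<in>filtered_level Q n u i. card (R x))"
    using finite_tree_level R_fin by (simp add: filtered_level_def)
  finally show ?thesis by (simp add: R_card)
qed

lemma tree_level_zero: "tree_level n u 0 = {replicate n None}"
  by (auto simp: tree_level_iff star_words_iff intro!: replicate_eqI)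

lemma card_filtered_level:
  assumes root: "Q 0 (int ` {..<n})"
    and branch: "\<And>i x. i < m \<Longrightarrow> x \<in> filtered_level Q n u i \<Longrightarrow>
      card {q \<in> removable (plus_mset u (Suc i)) (above i x). Q (Suc i) (above i x - {q})} = c i"
  shows "card (filtered_level Q n u m) = (\<Prod>i<m. c i)"
  using branch
proof (induction m)
  case 0
  have "filtered_level Q n u 0 = {replicate n None}"
    using root by (auto simp: filtered_level_def tree_level_zero above_zero)
  then show ?case by simp
next
  case (Suc m)
  have "card (filtered_level Q n u (Suc m)) = (\<Sum>x\<in>filtered_level Q n u m. c m)"
    unfolding card_filtered_level_Suc by (intro sum.cong refl Suc.prems) auto
  then show ?case using Suc by simp
qed

section \<open>Contours, leaves and labels\<close>

definition star_set :: "nat option list \<Rightarrow> int set" where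
  "star_set x = int ` {k. k < length x \<and> x ! k = None}"

lemma int_in_star_set: "int k \<in> star_set x \<longleftrightarrow> k < length x \<and> x ! k = None"
  by (auto simp: star_set_def)

lemma star_set_append_left:
  assumes "None \<notin> set a"
  shows "star_set (a @ x) = (+) (int (length a)) ` star_set x"
proof -
  have "{k. k < length (a @ x) \<and> (a @ x) ! k = None} = (+) (length a) ` {k. k < length x \<and> x ! k = None}"
  proof (intro set_eqI iffI)
    fix k assume k: "k \<in> {k. k < length (a @ x) \<and> (a @ x) ! k = None}"
    have "\<not> k < length a" using k assms by (metis (mono_tags, lifting) mem_Collect_eq nth_append nth_mem)
    then show "k \<in> (+) (length a) ` {k. k < length x \<and> x ! k = None}"
      using k by (intro image_eqI[of _ _ "k - length a"]) (auto simp: nth_append)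
  qed auto
  then show ?thesis by (simp add: star_set_def image_image)
qed

lemma star_set_append_right:
  assumes "None \<notin> set b"
  shows "star_set (x @ b) = star_set x"
proof -
  have "k < length (x @ b) \<and> (x @ b) ! k = None \<longleftrightarrow> k < length x \<and> x ! k = None" for k
  proof (cases "k < length x")
    case False
    have "(x @ b) ! k \<noteq> None" if k: "k < length (x @ b)"
    proof -
      have "(x @ b) ! k = b ! (k - length x)" "k - length x < length b"
        using False k by (auto simp: nth_append)
      then show ?thesis using assms nth_mem by metis
    qed
    then show ?thesis using False by blast
  qed (simp add: nth_append)
  then show ?thesis by (simp add: star_set_def)
qed

lemma star_factor_empty: "None \<notin> set x \<Longrightarrow> star_factor x = []"
proof -
  assume "None \<notin> set x"
  then have "\<forall>a\<in>set x. a \<noteq> None" by metis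
  then have "dropWhile (\<lambda>a. a \<noteq> None) x = []" by (simp only: dropWhile_eq_Nil_conv)
  then show ?thesis unfolding star_factor_def by (simp only: rev.simps dropWhile.simps)
qed

text \<open>
  Cutting off the parts before the first and after the last star only shifts the star set, and
  the factor that remains has stars at both ends.
\<close>

lemma star_factor_decomp:
  assumes "None \<in> set x"
  obtains a b where "x = a @ star_factor x @ b" "None \<notin> set a" "None \<notin> set b"
    "star_factor x \<noteq> []" "star_factor x ! 0 = None"
    "star_factor x ! (length (star_factor x) - 1) = None"
proof -
  let ?P = "\<lambda>a :: nat option. a \<noteq> None"
  define t where "t = dropWhile ?P x"
  define f where "f = star_factor x"
  have f: "f = rev (dropWhile ?P (rev t))" by (simp add: f_def t_def star_factor_def)
  have x: "x = takeWhile ?P x @ t" by (simp add: t_def)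
  have t_split: "t = f @ rev (takeWhile ?P (rev t))"
    unfolding f by (metis rev_append rev_rev_ident takeWhile_dropWhile_id)
  have no: "None \<notin> set (takeWhile ?P y)" for y by (auto dest: set_takeWhileD)
  have t_ne: "t \<noteq> []" using assms by (auto simp: t_def dropWhile_eq_Nil_conv)
  have hd_t: "hd t = None" using hd_dropWhile[of ?P x] t_ne by (simp add: t_def)
  have "None \<in> set (rev t)" using hd_t t_ne by (metis hd_in_set set_rev)
  then have ne: "dropWhile ?P (rev t) \<noteq> []" by (auto simp: dropWhile_eq_Nil_conv)
  then have f_ne: "f \<noteq> []" by (simp add: f)
  have "hd f = None" using hd_t t_split f_ne by (metis hd_append2)
  moreover have "last f = None" using hd_dropWhile[OF ne] by (simp add: f last_rev)
  ultimately have "f ! 0 = None" "f ! (length f - 1) = None"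
    using f_ne by (simp_all add: hd_conv_nth last_conv_nth)
  moreover have "x = takeWhile ?P x @ f @ rev (takeWhile ?P (rev t))" using x t_split by simp
  moreover have "None \<notin> set (rev (takeWhile ?P (rev t)))" using no[of "rev t"] by simp
  ultimately show thesis using that[of "takeWhile ?P x" "rev (takeWhile ?P (rev t))"] no[of x] f_ne
    unfolding f_def by blast
qed

lemma star_set_empty_iff: "star_set x = {} \<longleftrightarrow> None \<notin> set x"
  by (auto simp: star_set_def in_set_conv_nth)

text \<open>
  If both words contain stars, their star factors begin and end with a star. Hence the star
  sets of these factors can be translates only with translation vector 0, and their lengths are
  determined by the star sets.
\<close>

lemma contour_eq_iff: "contour x = contour y \<longleftrightarrow> translates (star_set x) (star_set y)"
proof (cases "None \<in> set x \<and> None \<in> set y")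
  case False
  have empty: "contour z = [] \<longleftrightarrow> None \<notin> set z" for z
    using star_factor_empty[of z] star_factor_decomp[of z] by (auto simp: contour_def)
  have "translates (star_set x) (star_set y) \<longleftrightarrow> None \<notin> set x \<and> None \<notin> set y"
    using False by (auto simp: translates_def star_set_empty_iff[symmetric])
  then show ?thesis using False empty[of x] empty[of y] by metis
next
  case True
  obtain a b where x: "x = a @ star_factor x @ b" "None \<notin> set a" "None \<notin> set b"
    and fx: "star_factor x \<noteq> []" "star_factor x ! 0 = None" "star_factor x ! (length (star_factor x) - 1) = None"
    using star_factor_decomp[of x] True by blast
  obtain c d where y: "y = c @ star_factor y @ d" "None \<notin> set c" "None \<notin> set d"
    and fy: "star_factor y \<noteq> []" "star_factor y ! 0 = None" "star_factor y ! (length (star_factor y) - 1) = None"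
    using star_factor_decomp[of y] True by blast
  define f g where "f = star_factor x" and "g = star_factor y"
  have shift: "translates (star_set f) (star_set x)" "translates (star_set g) (star_set y)"
  proof -
    have "a @ f @ b = x" unfolding f_def by (rule x(1)[symmetric])
    then have "star_set x = (+) (int (length a)) ` star_set f"
      using star_set_append_left[OF x(2), of "f @ b"] star_set_append_right[OF x(3), of f]
      by simp
    then show "translates (star_set f) (star_set x)" unfolding translates_def by blast
    have "c @ g @ d = y" unfolding g_def by (rule y(1)[symmetric])
    then have "star_set y = (+) (int (length c)) ` star_set g"
      using star_set_append_left[OF y(2), of "g @ d"] star_set_append_right[OF y(3), of g]
      by simp
    then show "translates (star_set g) (star_set y)" unfolding translates_def by blast
  qed
  have "contour x = contour y \<longleftrightarrow> length f = length g \<and> star_set f = star_set g"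
  proof -
    have "contour x = contour y \<longleftrightarrow>
        length f = length g \<and> (\<forall>k<length f. f ! k = None \<longleftrightarrow> g ! k = None)"
    proof -
      define h where "h = (\<lambda>a :: nat option. if a = None then Star else Circ)"
      have h: "h a = h b \<longleftrightarrow> (a = None \<longleftrightarrow> b = None)" for a b by (auto simp: h_def)
      have "contour x = contour y \<longleftrightarrow> map h f = map h g"
        by (simp only: contour_def h_def f_def g_def)
      then show ?thesis by (simp add: list_eq_iff_nth_eq h cong: conj_cong)
    qed
    also have "\<dots> \<longleftrightarrow> length f = length g \<and> star_set f = star_set g"
    proof (rule conj_cong[OF refl])
      assume len: "length f = length g"
      have "star_set f = star_set g \<longleftrightarrow>
          {k. k < length f \<and> f ! k = None} = {k. k < length g \<and> g ! k = None}"
        unfolding star_set_def by (rule inj_image_eq_iff) (rule inj_on_of_nat)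
      then show "(\<forall>k<length f. f ! k = None \<longleftrightarrow> g ! k = None) \<longleftrightarrow> star_set f = star_set g"
        using len by (auto simp: set_eq_iff)
    qed
    finally show ?thesis .
  qed
  also have "\<dots> \<longleftrightarrow> translates (star_set f) (star_set g)"
  proof
    assume "translates (star_set f) (star_set g)"
    then obtain e where e: "star_set g = (+) e ` star_set f" unfolding translates_def by blast
    have f0: "int 0 \<in> star_set f" "int (length f - 1) \<in> star_set f"
      using fx unfolding int_in_star_set f_def by auto
    have g0: "int 0 \<in> star_set g" "int (length g - 1) \<in> star_set g"
      using fy unfolding int_in_star_set g_def by auto
    have nonneg: "0 \<le> z" if "z \<in> star_set h" for z h using that by (auto simp: star_set_def)
    have "e \<in> star_set g" using f0(1) by (auto simp: e)
    moreover have "- e \<in> star_set f"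
    proof -
      obtain z where "z \<in> star_set f" "e + z = 0" using g0(1) unfolding e by auto
      then show ?thesis by (simp add: add_eq_0_iff)
    qed
    ultimately have "e = 0" using nonneg[of e g] nonneg[of "- e" f] by simp
    then have eq: "star_set f = star_set g" by (simp add: e)
    have "length f - 1 < length g" "length g - 1 < length f"
      using f0(2) g0(2) eq int_in_star_set by blast+
    then show "length f = length g \<and> star_set f = star_set g"
      using eq fx(1) fy(1) unfolding f_def g_def by simp
  qed (simp add: translates_refl)
  also have "\<dots> \<longleftrightarrow> translates (star_set x) (star_set y)"
    using shift translates_trans translates_sym by blast
  finally show ?thesis .
qed

lemma star_set_eq_above: "x \<in> star_words n i \<Longrightarrow> star_set x = above i x"
  using star_words_none_iff[of x n i] star_words_length[of x n i]
  unfolding star_set_def above_def int_in_above by (auto simp: image_iff)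

lemma permutation_facts:
  assumes "v \<in> permutations_of_set {1..n}"
  shows "length v = n" "set v = {1..n}" "distinct v" "v \<in> pos_words"
  using assms length_finite_permutations_of_set[OF assms]
  by (auto simp: permutations_of_set_def pos_words_def)

lemma above_map_Some:
  assumes "v \<in> pos_words"
  shows "above j (map Some v) = level_set v (Suc j)"
proof -
  have "v ! k \<notin> {1..j} \<longleftrightarrow> Suc j \<le> v ! k" if "k < length v" for k
    using assms nth_mem[OF that] by (auto simp: pos_words_def)
  then have "{k. k < length (map Some v) \<and> map Some v ! k \<notin> Some ` {1..j}}
      = {k. k < length v \<and> Suc j \<le> v ! k}"
    by auto
  then show ?thesis by (simp add: above_def level_set_def)
qed

lemma map_Some_in_star_words_iff:
  "map Some v \<in> star_words n n \<longleftrightarrow> v \<in> permutations_of_set {1..n}"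
proof
  assume w: "map Some v \<in> star_words n n"
  have len: "length v = n" using star_words_length[OF w] by simp
  have sub: "set v \<subseteq> {1..n}" using w by (auto simp: star_words_def)
  have "j \<in> set v" if j: "j \<in> {1..n}" for j
  proof -
    obtain k where "k < n" "map Some v ! k = Some j" using star_words_unique[OF w j] by blast
    then show ?thesis using len by (auto simp: in_set_conv_nth)
  qed
  then have "set v = {1..n}" using sub by blast
  then show "v \<in> permutations_of_set {1..n}"
    using len by (auto simp: permutations_of_set_def intro: card_distinct)
next
  assume "v \<in> permutations_of_set {1..n}"
  note v = permutation_facts[OF this]
  have "\<exists>!k. k < n \<and> map Some v ! k = Some j" if "j \<in> {1..n}" for j
  proof -
    have "j \<in> set v" using that v by simp
    then obtain k where k: "k < n" "v ! k = j" using v(1) by (auto simp: in_set_conv_nth)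
    then have "k' < n \<and> map Some v ! k' = Some j \<longleftrightarrow> k' = k" for k'
      using v(1,3) nth_eq_iff_index_eq[of v k' k] by auto
    then show ?thesis by simp
  qed
  moreover have "set (map Some v) = Some ` {1..n}" using v(2) by simp
  ultimately show "map Some v \<in> star_words n n" using v(1) unfolding star_words_iff by auto
qed

lemma plus_mset_eq_dists:
  assumes v: "v \<in> permutations_of_set {1..n}" and p: "p < n"
  shows "plus_mset v (v ! p) = dists (int p) (level_set v (Suc (v ! p)))"
proof -
  note vf = permutation_facts[OF v]
  let ?K = "{k. k < length v \<and> Suc (v ! p) \<le> v ! k}"
  have pos: "pos_of v (v ! k) = Suc k" if "k < n" for k
    unfolding pos_of_def
  proof (rule the_equality)
    fix m assume "m \<in> {1..length v} \<and> v ! (m - 1) = v ! k"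
    then show "m = Suc k" using vf that nth_eq_iff_index_eq[of v "m - 1" k] by auto
  qed (use that vf in auto)
  have "{v ! p<..length v} = (!) v ` ?K"
  proof (intro set_eqI iffI)
    fix a assume a: "a \<in> {v ! p<..length v}"
    then have "a \<in> set v" using vf by auto
    then show "a \<in> (!) v ` ?K" using a by (auto simp: in_set_conv_nth)
  next
    fix a assume "a \<in> (!) v ` ?K"
    then obtain k where k: "k < length v" "v ! p < v ! k" "a = v ! k" by auto
    then have "v ! k \<in> set v" by simp
    then show "a \<in> {v ! p<..length v}" using vf k by auto
  qed
  moreover have "inj_on ((!) v) ?K" using vf by (auto simp: inj_on_def nth_eq_iff_index_eq)
  ultimately have "mset_set {v ! p<..length v} = image_mset ((!) v) (mset_set ?K)"
    by (simp add: image_mset_mset_set)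
  then have "plus_mset v (v ! p)
      = image_mset (\<lambda>k. absdiff (pos_of v (v ! p)) (pos_of v (v ! k))) (mset_set ?K)"
    by (simp add: plus_mset_def multiset.map_comp o_def)
  also have "\<dots> = image_mset (\<lambda>k. nat \<bar>int p - int k\<bar>) (mset_set ?K)"
    using pos p vf by (intro image_mset_cong) (auto simp: absdiff_def)
  also have "\<dots> = image_mset (\<lambda>q. nat \<bar>int p - q\<bar>) (image_mset int (mset_set ?K))"
    by (simp add: multiset.map_comp o_def)
  also have "image_mset int (mset_set ?K) = mset_set (int ` ?K)"
    by (simp add: image_mset_mset_set)
  finally show ?thesis by (simp add: dists_def level_set_def)
qed

text \<open>
  The tree condition for the letter \<open>n\<close>, which cross equivalence omits, compares two empty
  multisets.
\<close>

lemma map_Some_in_tree_level_iff: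
  assumes u: "u \<in> permutations_of_set {1..n}"
  shows "map Some v \<in> tree_level n u n \<longleftrightarrow> v \<in> cross_class n u"
proof (cases "v \<in> permutations_of_set {1..n}")
  case False
  then show ?thesis
    using map_Some_in_star_words_iff[of v n] by (auto simp: tree_level_def cross_class_def)
next
  case v: True
  note vf = permutation_facts[OF v] and uf = permutation_facts[OF u]
  have "map Some v \<in> tree_level n u n \<longleftrightarrow>
    (\<forall>j\<in>{1..n}. \<forall>p<n. v ! p = j \<longrightarrow> plus_mset v j = plus_mset u j)"
    using v vf plus_mset_eq_dists[OF v]
    by (auto simp: tree_level_iff map_Some_in_star_words_iff above_map_Some)
  also have "\<dots> \<longleftrightarrow> (\<forall>j\<in>{1..n}. plus_mset v j = plus_mset u j)"
  proof -
    have "\<exists>p<n. v ! p = j" if "j \<in> {1..n}" for j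
    proof -
      have "j \<in> set v" using that vf by simp
      then show ?thesis using vf(1) by (auto simp: in_set_conv_nth)
    qed
    then show ?thesis by blast
  qed
  also have "\<dots> \<longleftrightarrow> v \<in> cross_class n u"
  proof -
    have last: "plus_mset v n = {#}" "plus_mset u n = {#}" using vf uf by (simp_all add: plus_mset_def)
    have "(\<forall>j\<in>{1..n}. plus_mset v j = plus_mset u j) \<longleftrightarrow>
        (\<forall>j. 1 \<le> j \<and> j \<le> n - 1 \<longrightarrow> plus_mset u j = plus_mset v j)"
      (is "?A \<longleftrightarrow> ?B")
    proof
      assume B: ?B
      show ?A
      proof
        fix j assume j: "j \<in> {1..n}"
        show "plus_mset v j = plus_mset u j"
        proof (cases "j = n")
          case False
          then have "1 \<le> j \<and> j \<le> n - 1" using j by auto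
          then show ?thesis using B by metis
        qed (use last in simp)
      qed
    next
      assume A: ?A
      have "j \<in> {1..n}" if "1 \<le> j \<and> j \<le> n - 1" for j using that by auto
      then show ?B using A by metis
    qed
    then show ?thesis using v by (simp add: cross_class_def)
  qed
  finally show ?thesis .
qed

lemma cross_class_permutations: "v \<in> cross_class n u \<Longrightarrow> v \<in> permutations_of_set {1..n}"
  by (simp add: cross_class_def)

lemma self_in_cross_class: "u \<in> permutations_of_set {1..n} \<Longrightarrow> u \<in> cross_class n u"
  by (simp add: cross_class_def)

lemma leaves_eq_cross_class:
  assumes "u \<in> permutations_of_set {1..n}" shows "leaves n u = cross_class n u"
  using map_Some_in_tree_level_iff[OF assms] by (simp add: leaves_def)

lemma tree_level_top:
  assumes "u \<in> permutations_of_set {1..n}"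
  shows "tree_level n u n = map Some ` cross_class n u"
proof (intro set_eqI iffI)
  fix x assume x: "x \<in> tree_level n u n"
  then have w: "x \<in> star_words n n" by (simp add: tree_level_def)
  have "None \<notin> set x" using w by (simp add: star_words_def count_list_0_iff)
  then have "\<forall>a\<in>set x. Some (the a) = a" by (metis option.exhaust_sel)
  then have eq: "x = map Some (map the x)" by (simp add: map_idI o_def)
  then show "x \<in> map Some ` cross_class n u"
    using x map_Some_in_tree_level_iff[OF assms] by (metis imageI)
qed (use map_Some_in_tree_level_iff[OF assms] in auto)

text \<open>
  In both vertices, the letter \<open>j + 1\<close> sits at a point removable for the same distance
  multiset, so congruence of the star sets passes to the next level.
\<close>

lemma above_congruent:
  assumes x: "x \<in> tree_level n u i" and y: "y \<in> tree_level n u i'"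
  shows "j \<le> i \<Longrightarrow> j \<le> i' \<Longrightarrow> congruent_sets (above j x) (above j y)"
proof (induction j)
  case 0
  have "length x = n" "length y = n" using x y by (auto simp: tree_level_def dest: star_words_length)
  then show ?case by (simp add: above_zero translates_imp_congruent translates_refl)
next
  case (Suc j)
  obtain p where p: "p \<in> removable (plus_mset u (Suc j)) (above j x)" "above (Suc j) x = above j x - {p}"
    using tree_level_step[OF x, of j] Suc.prems by auto
  obtain q where q: "q \<in> removable (plus_mset u (Suc j)) (above j y)" "above (Suc j) y = above j y - {q}"
    using tree_level_step[OF y, of j] Suc.prems by auto
  show ?case unfolding p(2) q(2)
    by (rule congruent_remove_removable[OF finite_above _ p(1) q(1)]) (use Suc in simp)
qed

text \<open>
  The leaf \<open>u\<close> shows that some star set of the level has a removable point; by congruence all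
  of them have one.
\<close>

lemma tree_level_nonempty:
  assumes "u \<in> permutations_of_set {1..n}"
  shows "i \<le> n \<Longrightarrow> tree_level n u i \<noteq> {}"
proof (induction i)
  case 0
  show ?case by (simp add: tree_level_zero)
next
  case (Suc i)
  then obtain x where x: "x \<in> tree_level n u i" by auto
  have top: "map Some u \<in> tree_level n u n"
    using map_Some_in_tree_level_iff[OF assms] self_in_cross_class[OF assms] by simp
  obtain q where "q \<in> removable (plus_mset u (Suc i)) (above i (map Some u))"
    using tree_level_step[OF top, of i] Suc.prems by auto
  then have "card (removable (plus_mset u (Suc i)) (above i (map Some u))) \<noteq> 0"
    using finite_removable[OF finite_above] by auto
  then have "card (removable (plus_mset u (Suc i)) (above i x)) \<noteq> 0"
    using card_removable_congruent[OF above_congruent[OF top x, of i]] Suc.prems by simp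
  then obtain r where r: "r \<in> removable (plus_mset u (Suc i)) (above i x)" by (metis card.empty ex_in_conv)
  then obtain p where "r = int p" by (auto simp: removable_def above_def)
  then show ?case using tree_level_update(1)[OF x] r by blast
qed

lemma vertex_labeled_iff:
  assumes x: "x \<in> tree_level n u i"
  shows "vertex_labeled n u i x b \<longleftrightarrow>
    (b = 0 \<and> branches True (plus_mset u (Suc i)) (above i x)) \<or>
    (b = 1 \<and> branches False (plus_mset u (Suc i)) (above i x))"
proof -
  define R where "R = removable (plus_mset u (Suc i)) (above i x)"
  define f where "f p = x[p := Some (Suc i)]" for p
  have R_nat: "\<exists>p. r = int p" if "r \<in> R" for r
    using that by (auto simp: R_def removable_def above_def)
  have kids: "children n u i x = f ` {p. int p \<in> R}"
    unfolding R_def f_def by (rule children_eq[OF x])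
  have len: "length x = n" using x by (auto simp: tree_level_def dest: star_words_length)
  have f_inj: "p = q" if "int p \<in> R" "int q \<in> R" "f p = f q" for p q
  proof (rule ccontr)
    assume "p \<noteq> q"
    have "p < n" "x ! p = None" using tree_level_update(4,5)[OF x] that(1) by (auto simp: R_def)
    then have "f p ! p = Some (Suc i)" "f q ! p = None" using \<open>p \<noteq> q\<close> len by (auto simp: f_def)
    then show False using that(3) by simp
  qed
  have contours: "contour (f p) = contour (f q) \<longleftrightarrow> translates (above i x - {int p}) (above i x - {int q})"
    if "int p \<in> R" "int q \<in> R" for p q
  proof -
    have "star_set (f r) = above i x - {int r}" if r: "int r \<in> R" for r
    proof -
      note upd = tree_level_update[OF x r[unfolded R_def]]
      have "f r \<in> star_words n (Suc i)" using upd(1) by (simp add: tree_level_def f_def)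
      then show ?thesis using star_set_eq_above upd(3) unfolding f_def by metis
    qed
    then show ?thesis using that by (simp add: contour_eq_iff)
  qed
  have "vertex_labeled n u i x b \<longleftrightarrow> (\<exists>p q. p \<noteq> q \<and> R = {p, q} \<and>
      b = (if translates (above i x - {p}) (above i x - {q}) then 0 else 1))" (is "_ \<longleftrightarrow> ?B")
  proof
    assume "vertex_labeled n u i x b"
    then obtain y z where yz: "y \<noteq> z" "children n u i x = {y, z}" "b = (if contour y = contour z then 0 else 1)"
      unfolding vertex_labeled_def by blast
    then have "y \<in> f ` {p. int p \<in> R}" "z \<in> f ` {p. int p \<in> R}" using kids by auto
    then obtain p q where p: "int p \<in> R" "y = f p" and q: "int q \<in> R" "z = f q" by blast
    have "r = int p \<or> r = int q" if r: "r \<in> R" for r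
    proof -
      obtain m where m: "r = int m" using R_nat[OF r] by blast
      then have "f m \<in> {y, z}" using kids yz(2) r by auto
      then show ?thesis using f_inj[of m p] f_inj[of m q] r m p q by auto
    qed
    then have "R = {int p, int q}" using p q by blast
    moreover have "int p \<noteq> int q" using p q yz(1) by auto
    moreover have "b = (if translates (above i x - {int p}) (above i x - {int q}) then 0 else 1)"
      using yz(3) contours[OF p(1) q(1)] p q by simp
    ultimately show ?B by blast
  next
    assume ?B
    then obtain r s where rs: "r \<noteq> s" "R = {r, s}"
      "b = (if translates (above i x - {r}) (above i x - {s}) then 0 else 1)" by blast
    obtain p q where pq: "r = int p" "s = int q" using R_nat rs(2) by blast
    have "{m. int m \<in> R} = {p, q}" using rs(2) pq by auto
    then have "children n u i x = {f p, f q}" using kids by simp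
    moreover have "f p \<noteq> f q" using f_inj[of p q] rs pq by auto
    moreover have "b = (if contour (f p) = contour (f q) then 0 else 1)"
      using rs pq contours[of p q] by simp
    ultimately show "vertex_labeled n u i x b" unfolding vertex_labeled_def by blast
  qed
  also have "\<dots> \<longleftrightarrow> (b = 0 \<and> branches True (plus_mset u (Suc i)) (above i x)) \<or>
    (b = 1 \<and> branches False (plus_mset u (Suc i)) (above i x))"
    unfolding branches_def R_def by auto
  finally show ?thesis .
qed

text \<open>
  The star set of the ancestor of any leaf \<open>v\<close> may be used to read off the label, since all
  star sets of the level are congruent.
\<close>

lemma level_labeled_iff:
  assumes u: "u \<in> permutations_of_set {1..n}" and v: "v \<in> cross_class n u" and i: "i \<le> n"
  shows "level_labeled n u i 0 \<longleftrightarrow> branches True (plus_mset u (Suc i)) (level_set v (Suc i))"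
    "level_labeled n u i 1 \<longleftrightarrow> branches False (plus_mset u (Suc i)) (level_set v (Suc i))"
proof -
  have top: "map Some v \<in> tree_level n u n" using map_Some_in_tree_level_iff[OF u] v by simp
  have av: "above i (map Some v) = level_set v (Suc i)"
    by (rule above_map_Some[OF permutation_facts(4)[OF cross_class_permutations[OF v]]])
  have same: "branches b (plus_mset u (Suc i)) (above i x)
      \<longleftrightarrow> branches b (plus_mset u (Suc i)) (level_set v (Suc i))" if x: "x \<in> tree_level n u i" for x b
    using branches_congruent above_congruent[OF x top order_refl i] above_congruent[OF top x i order_refl]
    unfolding av by blast
  have "level_labeled n u i b \<longleftrightarrow>
      (b = 0 \<and> branches True (plus_mset u (Suc i)) (level_set v (Suc i))) \<or>
      (b = 1 \<and> branches False (plus_mset u (Suc i)) (level_set v (Suc i)))" for b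
    using tree_level_nonempty[OF u i] by (auto simp: level_labeled_def vertex_labeled_iff same)
  then show "level_labeled n u i 0 \<longleftrightarrow> branches True (plus_mset u (Suc i)) (level_set v (Suc i))"
    "level_labeled n u i 1 \<longleftrightarrow> branches False (plus_mset u (Suc i)) (level_set v (Suc i))"
    by simp_all
qed

section \<open>Counting leaves and classes\<close>

lemma level_set_Suc_perm:
  assumes v: "v \<in> permutations_of_set {1..n}" and p: "p < n" "v ! p = Suc j"
  shows "level_set v (Suc (Suc j)) = level_set v (Suc j) - {int p}" "int p \<in> level_set v (Suc j)"
proof -
  note vf = permutation_facts[OF v]
  have w: "map Some v \<in> star_words n n" by (simp only: map_Some_in_star_words_iff v)
  have "v ! p \<in> set v" using vf(1) p(1) by simp
  then have "j < n" using p vf(2) by simp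
  moreover have "map Some v ! p = Some (Suc j)" using p vf by simp
  ultimately show "level_set v (Suc (Suc j)) = level_set v (Suc j) - {int p}"
    "int p \<in> level_set v (Suc j)"
    using above_Suc_eq[OF w _ p(1), of j] by (simp_all add: above_map_Some[OF vf(4)])
qed

text \<open>
  Translates have equal size, so the level sets of \<open>w\<close> shrink strictly at each of the steps
  \<open>1, \<dots>, n\<close>, just as those of \<open>v\<close> do. Hence each of these letters occurs in \<open>w\<close>.
\<close>

lemma permutation_if_translates:
  assumes v: "v \<in> permutations_of_set {1..n}" and len: "length w = n"
    and tr: "\<And>t. translates (level_set v t) (level_set w t)"
  shows "w \<in> permutations_of_set {1..n}"
proof -
  note vf = permutation_facts[OF v]
  have "a \<in> set w" if a: "a \<in> {1..n}" for a
  proof (rule ccontr)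
    assume "a \<notin> set w"
    then have "w ! k \<noteq> a" if "k < length w" for k using that nth_mem by metis
    then have "{k. k < length w \<and> a \<le> w ! k} = {k. k < length w \<and> Suc a \<le> w ! k}"
      by (auto simp: Suc_le_eq order.order_iff_strict)
    then have "level_set w a = level_set w (Suc a)" by (simp add: level_set_def)
    then have "card (level_set v a) = card (level_set v (Suc a))"
      using translates_card[OF tr] by metis
    moreover have "a \<in> set v" using a vf by simp
    then obtain p where p: "p < n" "v ! p = a" using vf(1) by (auto simp: in_set_conv_nth)
    have "level_set v (Suc a) = level_set v a - {int p}" "int p \<in> level_set v a"
      using level_set_Suc_perm[OF v p(1), of "a - 1"] p(2) a by simp_all
    then have "card (level_set v (Suc a)) < card (level_set v a)"
      using finite_level_set by (metis card_Diff1_less)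
    ultimately show False by simp
  qed
  then have sub: "{1..n} \<subseteq> set w" by blast
  have "card (set w) \<le> n" using card_length[of w] len by simp
  then have "{1..n} = set w" using sub by (intro card_seteq) auto
  then have set_w: "set w = {1..n}" by (rule sym)
  then have "distinct w" using len by (intro card_distinct) simp
  then show ?thesis using set_w by (simp add: permutations_of_set_def)
qed

lemma plus_mset_eq_if_translates:
  assumes v: "v \<in> permutations_of_set {1..n}" and w: "w \<in> permutations_of_set {1..n}"
    and tr: "\<And>t. translates (level_set v t) (level_set w t)" and i: "i \<in> {1..n}"
  shows "plus_mset v i = plus_mset w i"
proof -
  have "i \<in> set v" "i \<in> set w" using i permutation_facts[OF v] permutation_facts[OF w] by auto
  then obtain p q where p: "p < n" "v ! p = i" and q: "q < n" "w ! q = i"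
    using permutation_facts(1)[OF v] permutation_facts(1)[OF w] by (auto simp: in_set_conv_nth)
  have pv: "level_set v (Suc i) = level_set v i - {int p}" "int p \<in> level_set v i"
    using level_set_Suc_perm[OF v p(1), of "i - 1"] p(2) i by simp_all
  have qw: "level_set w (Suc i) = level_set w i - {int q}" "int q \<in> level_set w i"
    using level_set_Suc_perm[OF w q(1), of "i - 1"] q(2) i by simp_all
  have "dists (int p) (level_set v i - {int p}) = dists (int q) (level_set w i - {int q})"
    using tr[of i] tr[of "Suc i"] pv qw
    by (intro dists_eq_if_translates finite_level_set) auto
  then show ?thesis
    using plus_mset_eq_dists[OF v p(1)] plus_mset_eq_dists[OF w q(1)] p(2) q(2) pv(1) qw(1) by simp
qed

text \<open>
  A word equivalent to a leaf is again a leaf: it is a permutation, and its multisets of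
  distances are determined by the translation classes of its level sets.
\<close>

lemma super_strong_Wilf_class:
  assumes v: "v \<in> cross_class n u"
  shows "super_strong_Wilf `` {v}
    = {w \<in> cross_class n u. \<forall>j\<le>n. translates (level_set v (Suc j)) (level_set w (Suc j))}"
proof (intro set_eqI iffI)
  note vp = cross_class_permutations[OF v]
  note vf = permutation_facts[OF vp]
  fix w assume "w \<in> super_strong_Wilf `` {v}"
  then have ss: "(v, w) \<in> super_strong_Wilf" by blast
  have tr: "translates (level_set v t) (level_set w t)" for t
    by (rule super_strong_Wilf_imp_translates(2)[OF ss])
  have "length w = n" using super_strong_Wilf_imp_translates(1)[OF ss] vf by simp
  then have wp: "w \<in> permutations_of_set {1..n}" using permutation_if_translates[OF vp _ tr] by simp
  have "plus_mset u i = plus_mset w i" if "1 \<le> i \<and> i \<le> n - 1" for i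
    using that v plus_mset_eq_if_translates[OF vp wp tr, of i] by (auto simp: cross_class_def)
  then have "w \<in> cross_class n u" using wp by (simp add: cross_class_def)
  then show "w \<in> {w \<in> cross_class n u. \<forall>j\<le>n. translates (level_set v (Suc j)) (level_set w (Suc j))}"
    using tr by simp
next
  note vf = permutation_facts[OF cross_class_permutations[OF v]]
  fix w assume "w \<in> {w \<in> cross_class n u. \<forall>j\<le>n. translates (level_set v (Suc j)) (level_set w (Suc j))}"
  then have wc: "w \<in> cross_class n u"
    and tr: "\<And>j. j \<le> n \<Longrightarrow> translates (level_set v (Suc j)) (level_set w (Suc j))" by auto
  note wf = permutation_facts[OF cross_class_permutations[OF wc]]
  have "translates (level_set v t) (level_set w t)" for t
  proof (cases t)
    case 0
    then show ?thesis using vf wf by (simp add: level_set_pos_word translates_refl)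
  next
    case (Suc j)
    show ?thesis
    proof (cases "j \<le> n")
      case False
      then have "level_set v t = {}" "level_set w t = {}"
        using vf wf Suc by (auto intro!: level_set_empty)
      then show ?thesis by (simp add: translates_refl)
    qed (use tr Suc in simp)
  qed
  then show "w \<in> super_strong_Wilf `` {v}"
    using super_strong_Wilf_iff[OF vf(4) wf(4)] vf(1) wf(1) by simp
qed

lemma card_labels_below:
  assumes u: "u \<in> permutations_of_set {1..n}" and b: "b = 0 \<or> b = 1"
  shows "{i \<in> {0..n}. level_labeled n u i b} = {i \<in> {..<n}. level_labeled n u i b}"
proof -
  have "level_set u (Suc n) = {}"
    using permutation_facts(2)[OF u] by (auto intro!: level_set_empty)
  then have "\<not> level_labeled n u n b"
    using b level_labeled_iff[OF u self_in_cross_class[OF u] order_refl]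
    by (auto simp: branches_def removable_def)
  then have "i < n" if "i \<le> n" "level_labeled n u i b" for i using that by (metis le_neq_implies_less)
  then show ?thesis by auto
qed

lemma prod_two_or_one:
  fixes n :: nat
  shows "(\<Prod>i<n. if P i then 2 else 1 :: nat) = 2 ^ card {i \<in> {..<n}. P i}"
proof -
  have "(\<Prod>i<n. if P i then 2 else 1 :: nat) = (\<Prod>i\<in>{i \<in> {..<n}. P i}. 2)"
    by (rule prod.inter_filter[symmetric]) simp
  then show ?thesis by simp
qed

lemma branches_exclusive: "\<not> (branches True D S \<and> branches False D S)"
proof
  assume "branches True D S \<and> branches False D S"
  then obtain p q where "p \<noteq> q" "removable D S = {p, q}" by (auto simp: branches_def)
  then show False
    using \<open>branches True D S \<and> branches False D S\<close> branches_iff[of D S p q] by blast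
qed

lemma parent_removal:
  assumes u: "u \<in> permutations_of_set {1..n}" and v: "v \<in> cross_class n u" and i: "i < n"
  obtains p where "p \<in> removable (plus_mset u (Suc i)) (level_set v (Suc i))"
    "level_set v (Suc (Suc i)) = level_set v (Suc i) - {p}"
proof -
  have "map Some v \<in> tree_level n u n" using map_Some_in_tree_level_iff[OF u] v by simp
  then obtain q where "q \<in> removable (plus_mset u (Suc i)) (above i (map Some v))"
    "above (Suc i) (map Some v) = above i (map Some v) - {q}"
    using tree_level_step i by blast
  then show thesis
    using that above_map_Some[OF permutation_facts(4)[OF cross_class_permutations[OF v]]] by simp
qed

text \<open>
  Each vertex has as many children as the star set of \<open>u\<close> on the same level, namely two on a
  labeled level and one otherwise.
\<close>

lemma card_cross_class:
  assumes u: "u \<in> permutations_of_set {1..n}"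
  shows "card (cross_class n u) = 2 ^ (card {i \<in> {0..n}. level_labeled n u i 0}
    + card {i \<in> {0..n}. level_labeled n u i 1})"
proof -
  let ?Q = "\<lambda>(_::nat) (_::int set). True"
  note uc = self_in_cross_class[OF u]
  have top: "map Some u \<in> tree_level n u n" using map_Some_in_tree_level_iff[OF u] uc by simp
  have "card (filtered_level ?Q n u n)
      = (\<Prod>i<n. if level_labeled n u i 0 \<or> level_labeled n u i 1 then 2 else 1)"
  proof (rule card_filtered_level)
    fix i x assume i: "i < n" and "x \<in> filtered_level ?Q n u i"
    then have x: "x \<in> tree_level n u i" by (simp add: filtered_level_def)
    obtain p where p: "p \<in> removable (plus_mset u (Suc i)) (level_set u (Suc i))"
      by (rule parent_removal[OF u uc i])
    have "congruent_sets (level_set u (Suc i)) (above i x)"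
      using above_congruent[OF top x, of i] i above_map_Some[OF permutation_facts(4)[OF u]] by simp
    then have "card (removable (plus_mset u (Suc i)) (above i x))
        = card (removable (plus_mset u (Suc i)) (level_set u (Suc i)))"
      by (rule card_removable_congruent)
    also have "\<dots> = (if level_labeled n u i 0 \<or> level_labeled n u i 1 then 2 else 1)"
      using card_removable[OF finite_level_set p] level_labeled_iff[OF u uc, of i] i by simp
    finally show "card {q \<in> removable (plus_mset u (Suc i)) (above i x). True}
        = (if level_labeled n u i 0 \<or> level_labeled n u i 1 then 2 else 1)" by simp
  qed simp
  also have "\<dots> = 2 ^ card {i \<in> {..<n}. level_labeled n u i 0 \<or> level_labeled n u i 1}"
    by (rule prod_two_or_one)
  also have "{i \<in> {..<n}. level_labeled n u i 0 \<or> level_labeled n u i 1}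
      = {i \<in> {0..n}. level_labeled n u i 0} \<union> {i \<in> {0..n}. level_labeled n u i 1}"
    using card_labels_below[OF u, of 0] card_labels_below[OF u, of 1] by auto
  also have "card \<dots> = card {i \<in> {0..n}. level_labeled n u i 0} + card {i \<in> {0..n}. level_labeled n u i 1}"
    using level_labeled_iff[OF u uc] branches_exclusive by (intro card_Un_disjoint) auto
  finally have "card (filtered_level ?Q n u n) = 2 ^ (card {i \<in> {0..n}. level_labeled n u i 0}
    + card {i \<in> {0..n}. level_labeled n u i 1})" .
  moreover have "filtered_level ?Q n u n = map Some ` cross_class n u"
    using tree_level_top[OF u] by (simp add: filtered_level_def)
  moreover have "card (map Some ` cross_class n u) = card (cross_class n u)"
    by (intro card_image) (auto intro: inj_onI dest: map_injective)
  ultimately show ?thesis by simp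
qed

text \<open>
  Among the children of a vertex whose star set is a translate of that of \<open>v\<close>, both continue to
  match \<open>v\<close> on a level labeled 0, and exactly one does on any other level.
\<close>

lemma card_super_strong_Wilf_class:
  assumes u: "u \<in> permutations_of_set {1..n}" and v: "v \<in> cross_class n u"
  shows "card (super_strong_Wilf `` {v}) = 2 ^ card {i \<in> {0..n}. level_labeled n u i 0}"
proof -
  define Q where "Q j S = translates (level_set v (Suc j)) S" for j S
  note vf = permutation_facts[OF cross_class_permutations[OF v]]
  have "card (filtered_level Q n u n) = (\<Prod>i<n. if level_labeled n u i 0 then 2 else 1)"
  proof (rule card_filtered_level)
    show "Q 0 (int ` {..<n})"
      using vf by (simp add: Q_def level_set_pos_word translates_refl)
    fix i x assume i: "i < n" and "x \<in> filtered_level Q n u i"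
    then have tr: "translates (level_set v (Suc i)) (above i x)"
      by (simp add: filtered_level_def Q_def)
    obtain p where p: "p \<in> removable (plus_mset u (Suc i)) (level_set v (Suc i))"
      "level_set v (Suc (Suc i)) = level_set v (Suc i) - {p}"
      by (rule parent_removal[OF u v i])
    show "card {q \<in> removable (plus_mset u (Suc i)) (above i x). Q (Suc i) (above i x - {q})}
        = (if level_labeled n u i 0 then 2 else 1)"
      using card_translating_removals[OF finite_level_set tr p(1)] level_labeled_iff(1)[OF u v, of i] i
      by (simp add: Q_def p(2))
  qed
  also have "\<dots> = 2 ^ card {i \<in> {..<n}. level_labeled n u i 0}" by (rule prod_two_or_one)
  also have "{i \<in> {..<n}. level_labeled n u i 0} = {i \<in> {0..n}. level_labeled n u i 0}"
    using card_labels_below[OF u, of 0] by simp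
  finally have "card (filtered_level Q n u n) = 2 ^ card {i \<in> {0..n}. level_labeled n u i 0}" .
  moreover have "filtered_level Q n u n = map Some ` (super_strong_Wilf `` {v})"
  proof -
    have "above j (map Some w) = level_set w (Suc j)" if "w \<in> cross_class n u" for j w
      by (rule above_map_Some[OF permutation_facts(4)[OF cross_class_permutations[OF that]]])
    then show ?thesis
      unfolding filtered_level_def tree_level_top[OF u] super_strong_Wilf_class[OF v] Q_def by auto
  qed
  moreover have "card (map Some ` (super_strong_Wilf `` {v})) = card (super_strong_Wilf `` {v})"
    by (intro card_image) (auto intro: inj_onI dest: map_injective)
  ultimately show ?thesis by simp
qed

theorem corollary2:
  fixes n k l :: nat and u :: "nat list"
  assumes "u \<in> permutations_of_set {1..n}"
    and "k = card {i \<in> {0..n}. level_labeled n u i 0}"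
    and "l = card {i \<in> {0..n}. level_labeled n u i 1}"
  shows "(\<forall>C \<in> pos_words // super_strong_Wilf. C \<subseteq> leaves n u \<longrightarrow> card C = 2 ^ k) \<and>
    partition_on (cross_class n u)
      {C \<in> pos_words // super_strong_Wilf. C \<subseteq> cross_class n u} \<and>
    card {C \<in> pos_words // super_strong_Wilf. C \<subseteq> cross_class n u} = 2 ^ l"
proof -
  let ?X = "cross_class n u"
  let ?P = "{C \<in> pos_words // super_strong_Wilf. C \<subseteq> ?X}"
  note u = assms(1) and equiv = equiv_super_strong_Wilf
  have card_C: "card C = 2 ^ k" if "C \<in> ?P" for C
  proof -
    have "C \<in> pos_words // super_strong_Wilf" using that by blast
    then obtain v where v: "v \<in> pos_words" "C = super_strong_Wilf `` {v}"
      by (rule quotientE)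
    then have "v \<in> C" using equiv_class_self[OF equiv] by blast
    then have "v \<in> ?X" using that by blast
    then show ?thesis using card_super_strong_Wilf_class[OF u] v(2) assms(2) by simp
  qed
  have class_in: "super_strong_Wilf `` {v} \<in> ?P" and mem: "v \<in> super_strong_Wilf `` {v}" if "v \<in> ?X" for v
  proof -
    have v: "v \<in> pos_words" by (rule permutation_facts(4)[OF cross_class_permutations[OF that]])
    then show "v \<in> super_strong_Wilf `` {v}" by (rule equiv_class_self[OF equiv])
    show "super_strong_Wilf `` {v} \<in> ?P"
      using quotientI[OF v, of super_strong_Wilf] super_strong_Wilf_class[OF that] by auto
  qed
  have union: "\<Union>?P = ?X"
  proof
    show "?X \<subseteq> \<Union>?P"
    proof
      fix v assume v: "v \<in> ?X"
      show "v \<in> \<Union>?P" by (rule UnionI[OF class_in[OF v] mem[OF v]])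
    qed
  qed blast
  have disj: "C \<inter> D = {}" if "C \<in> ?P" "D \<in> ?P" "C \<noteq> D" for C D
    using that quotient_disj[OF equiv, of C D] by blast
  have part: "partition_on ?X ?P"
  proof (rule partition_onI)
    show "\<Union>?P = ?X" by (rule union)
    show "disjnt C D" if "C \<in> ?P" "D \<in> ?P" "C \<noteq> D" for C D
      unfolding disjnt_def by (rule disj[OF that])
    show "{} \<notin> ?P" using in_quotient_imp_non_empty[OF equiv] by blast
  qed
  have fin: "finite ?X" by (rule finite_subset[of _ "permutations_of_set {1..n}"]) (auto simp: cross_class_def)
  have "finite ?P" by (rule finite_subset[of _ "Pow ?X"]) (use fin in auto)
  then have "2 ^ k * card ?P = card (\<Union>?P)"
    using fin card_C disj unfolding union by (intro card_partition[of ?P, unfolded union]) auto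
  also have "\<dots> = 2 ^ k * 2 ^ l" using card_cross_class[OF u] assms(2,3) by (simp add: union power_add)
  finally have "card ?P = 2 ^ l" by simp
  then show ?thesis using part card_C leaves_eq_cross_class[OF u] by simp
qed

end
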